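(* Let $H$ be a nonzero complex Hilbert space, let $\mathcal C=S_1(H)_+$ be the cone of positive trace-class operators on $H$, and let $\varepsilon\ge0$. Let $S:\mathcal C\to\mathcal C$ be a map such that $$\bigl|\|S(A)-S(B)\|_1-\|A-B\|_1\bigr|\le\varepsilon\qquad\text{for all }A,B\in\mathcal C.$$ If $$\sup_{A\in\mathcal C}\|S(A)-A\|_\infty<\infty,$$ then $$\bigl\|(S(D)-S(E))-(D-E)\bigr\|_1\le3\varepsilon\qquad\text{for all }D,E\in\mathcal C.$$
   Context: $H$ may have any dimension and need not be separable. $S_1(H)$ denotes the trace-class operators on $H$, $\|X\|_1=\operatorname{Tr}|X|$ the trace norm, and $\|X\|_\infty$ the operator norm. No surjectivity, linearity, continuity or preservation of zero is assumed for $S$. *)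

theory Defs
  imports "HOL-Analysis.Analysis"
begin

text \<open>
  A complex inner product space is a complex vector space whose underlying real space is the
  library's \<^class>\<open>real_inner\<close>, with real inner product the real part of the complex one.
  The complex inner product is conjugate-linear in its first argument. Positive definiteness
  and \<open>\<langle>x, x\<rangle> = \<parallel>x\<parallel>\<^sup>2\<close> are inherited from \<^class>\<open>real_inner\<close>.
\<close>

class complex_inner = real_inner +
  fixes scaleC :: "complex \<Rightarrow> 'a \<Rightarrow> 'a"  (infixr \<open>*\<^sub>C\<close> 75)
    and cinner :: "'a \<Rightarrow> 'a \<Rightarrow> complex"
  assumes scaleC_add_right: "a *\<^sub>C (x + y) = a *\<^sub>C x + a *\<^sub>C y"
    and scaleC_add_left: "(a + b) *\<^sub>C x = a *\<^sub>C x + b *\<^sub>C x"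
    and scaleC_scaleC: "a *\<^sub>C b *\<^sub>C x = (a * b) *\<^sub>C x"
    and scaleC_of_real: "complex_of_real r *\<^sub>C x = r *\<^sub>R x"
    and cinner_commute: "cinner x y = cnj (cinner y x)"
    and cinner_add_right: "cinner x (y + z) = cinner x y + cinner x z"
    and cinner_scaleC_right: "cinner x (a *\<^sub>C y) = a * cinner x y"
    and Re_cinner: "Re (cinner x y) = inner x y"

class complex_hilbert = complex_inner + complete_space

instantiation complex :: complex_hilbert
begin

definition scaleC_complex :: "complex \<Rightarrow> complex \<Rightarrow> complex"
  where "scaleC_complex a x = a * x"

definition cinner_complex :: "complex \<Rightarrow> complex \<Rightarrow> complex"
  where "cinner_complex x y = cnj x * y"

instance
  by standard
    (auto simp: scaleC_complex_def cinner_complex_def algebra_simps scaleR_conv_of_real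
      inner_complex_def)

end

text \<open>
  Bounded operators on \<open>H\<close> are the elements of the library type \<open>'a \<Rightarrow>\<^sub>L 'a\<close> of bounded
  real-linear maps that are moreover complex-linear; the norm of that type is the operator norm.
\<close>

definition complex_linear :: "('a::complex_hilbert \<Rightarrow>\<^sub>L 'a) \<Rightarrow> bool"
  where "complex_linear T \<longleftrightarrow> (\<forall>a x. blinfun_apply T (a *\<^sub>C x) = a *\<^sub>C blinfun_apply T x)"

definition positive_op :: "('a::complex_hilbert \<Rightarrow>\<^sub>L 'a) \<Rightarrow> bool"
  where "positive_op T \<longleftrightarrow>
    complex_linear T \<and> (\<forall>x. cinner x (blinfun_apply T x) \<in> \<real>\<^sub>\<ge>\<^sub>0)"

definition adjoint_op :: "('a::complex_hilbert \<Rightarrow>\<^sub>L 'a) \<Rightarrow> ('a \<Rightarrow>\<^sub>L 'a)"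
  where "adjoint_op T =
    (THE U. \<forall>x y. cinner (blinfun_apply U x) y = cinner x (blinfun_apply T y))"

text \<open>\<open>|T|\<close> is the unique positive square root of \<open>T\<^sup>* T\<close>.\<close>

definition abs_op :: "('a::complex_hilbert \<Rightarrow>\<^sub>L 'a) \<Rightarrow> ('a \<Rightarrow>\<^sub>L 'a)"
  where "abs_op T = (THE P. positive_op P \<and> P o\<^sub>L P = adjoint_op T o\<^sub>L T)"

text \<open>An orthonormal basis is a maximal orthonormal set, of any cardinality.\<close>

definition orthonormal_basis :: "'a::complex_hilbert set \<Rightarrow> bool"
  where "orthonormal_basis B \<longleftrightarrow>
    (\<forall>e\<in>B. \<forall>f\<in>B. cinner e f = (if e = f then 1 else 0)) \<and>
    (\<forall>x. (\<forall>e\<in>B. cinner e x = 0) \<longrightarrow> x = 0)"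

text \<open>
  For positive operators summability of the diagonal, and for trace-class operators the value
  of the trace, do not depend on the orthonormal basis.
\<close>

definition trace_class :: "('a::complex_hilbert \<Rightarrow>\<^sub>L 'a) \<Rightarrow> bool"
  where "trace_class T \<longleftrightarrow> complex_linear T \<and>
    (\<exists>B. orthonormal_basis B \<and> (\<lambda>e. cinner e (blinfun_apply (abs_op T) e)) summable_on B)"

definition trace_op :: "('a::complex_hilbert \<Rightarrow>\<^sub>L 'a) \<Rightarrow> complex"
  where "trace_op T = (\<Sum>\<^sub>\<infinity>e\<in>(SOME B. orthonormal_basis B). cinner e (blinfun_apply T e))"

text \<open>The trace of the positive operator \<open>|T|\<close> is real. Meaningful for trace-class \<open>T\<close> only.\<close>

definition trace_norm :: "('a::complex_hilbert \<Rightarrow>\<^sub>L 'a) \<Rightarrow> real"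
  where "trace_norm T = Re (trace_op (abs_op T))"

definition trace_class_cone :: "('a::complex_hilbert \<Rightarrow>\<^sub>L 'a) set"
  where "trace_class_cone = {T. trace_class T \<and> positive_op T}"

end

theory Submission
  imports Defs
begin

text \<open>
  Write \<open>q\<^sub>X(x) = \<langle>x, X x\<rangle>\<close>. For a difference \<open>X\<close> of positive trace-class operators, \<open>\<parallel>X\<parallel>\<^sub>1\<close> is the
  supremum of \<open>\<Sum>g\<in>G. w(g) q\<^sub>X(g)\<close> over finite orthonormal sets \<open>G\<close> and weights \<open>\<bar>w\<bar> \<le> 1\<close>
  (\<open>weighted_sum_qform_le_trace_norm\<close>, \<open>trace_norm_almost_attained\<close>). So it suffices to bound
  \<open>\<Sum>e\<in>F. \<bar>q\<^sub>Y(e)\<bar>\<close> for \<open>Y = (S D - S E) - (D - E)\<close> and finite orthonormal \<open>F\<close>, and \<open>F\<close> may be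
  enlarged until \<open>D\<close>, \<open>E\<close>, \<open>S D\<close> and \<open>S E\<close> have almost no trace outside its span.

  Let \<open>\<sigma>(e)\<close> be the negative of the sign of \<open>q\<^sub>Y(e)\<close>, and let \<open>P\<close> and \<open>Q\<close> be the projections onto the
  spans of the \<open>e\<close> with \<open>\<sigma>(e) = 1\<close> and \<open>\<sigma>(e) = -1\<close>. For large \<open>t\<close> the operators \<open>t P\<close> and \<open>t Q\<close>
  serve as probes. Since \<open>S\<close> moves them by a bounded amount, \<open>X = S (t P) - S (t Q)\<close> is
  \<open>t (P - Q)\<close> up to a bounded error. The estimate \<open>block_estimate\<close> says that for such \<open>X\<close> the off-diagonal
  blocks and the deviation of the sign of \<open>X\<close> from \<open>P - Q\<close> on the span of \<open>F\<close> cost only \<open>O(1/t)\<close>,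
  so that \<open>\<parallel>X\<parallel>\<^sub>1\<close> is almost attained by the weight \<open>\<sigma>\<close> on \<open>F\<close> together with some finite \<open>G\<close>
  orthogonal to \<open>F\<close>. Test \<open>S (t P) - S D\<close> with these weights and \<open>S (t Q) - S E\<close> with their negatives
  and add: as \<open>\<parallel>X\<parallel>\<^sub>1 \<ge> t card F - \<epsilon>\<close>, the sum of \<open>\<parallel>S (t P) - S D\<parallel>\<^sub>1\<close> and \<open>\<parallel>S (t Q) - S E\<parallel>\<^sub>1\<close>
  is at least about \<open>t card F - \<epsilon> - \<Sum>e\<in>F. \<sigma>(e) \<langle>e, (S D - S E) e\<rangle>\<close>. By the hypothesis it is at
  most \<open>2 \<epsilon> + \<parallel>t P - D\<parallel>\<^sub>1 + \<parallel>t Q - E\<parallel>\<^sub>1\<close>, which is about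
  \<open>2 \<epsilon> + t card F - \<Sum>e\<in>F. \<sigma>(e) \<langle>e, (D - E) e\<rangle>\<close>. The terms \<open>t card F\<close> cancel and
  \<open>\<Sum>e\<in>F. \<bar>q\<^sub>Y(e)\<bar> \<le> 3 \<epsilon>\<close> remains in the limit. The part of \<open>X\<close> outside the span of \<open>F\<close>, which need
  not be small, cancels because it is tested with the same weights in both differences.

  The absolute value comes from a norm-convergent iteration for positive square roots. That the
  supremum above equals \<open>Tr \<bar>X\<bar>\<close> rests on an orthonormal basis adapted to the subspace where \<open>\<bar>X\<bar> = X\<close>
  (\<open>norming_basis_exists\<close>).
\<close>

section \<open>Complex inner products, self-adjoint and positive operators\<close>

instance complex_hilbert \<subseteq> banach ..

lemma cinner_add_left: "cinner (x + y) z = cinner x z + cinner y z"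
  for x :: "'a::complex_inner"
  by (metis cinner_add_right cinner_commute complex_cnj_add)

lemma cinner_scaleC_left: "cinner (a *\<^sub>C x) y = cnj a * cinner x y"
  for x :: "'a::complex_inner"
  by (metis cinner_commute cinner_scaleC_right complex_cnj_mult)

lemma cinner_scaleR_right: "cinner x (r *\<^sub>R y) = of_real r * cinner x y"
  for x :: "'a::complex_inner"
  by (metis cinner_scaleC_right scaleC_of_real)

lemma cinner_scaleR_left: "cinner (r *\<^sub>R x) y = of_real r * cinner x y"
  for x :: "'a::complex_inner"
  by (metis cinner_scaleC_left scaleC_of_real complex_cnj_complex_of_real)

lemma cinner_zero_right [simp]: "cinner x 0 = 0" for x :: "'a::complex_inner"
  using cinner_scaleR_right[of x 0 0] by simp

lemma cinner_zero_left [simp]: "cinner 0 x = 0" for x :: "'a::complex_inner"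
  using cinner_scaleR_left[of 0 0 x] by simp

lemma cinner_diff_right: "cinner x (y - z) = cinner x y - cinner x z" for x :: "'a::complex_inner"
  using cinner_add_right[of x "y - z" z] by (simp add: algebra_simps)

lemma cinner_diff_left: "cinner (y - z) x = cinner y x - cinner z x" for x :: "'a::complex_inner"
  using cinner_add_left[of "y - z" z x] by (simp add: algebra_simps)

lemma cinner_sum_right: "cinner x (\<Sum>i\<in>I. f i) = (\<Sum>i\<in>I. cinner x (f i))"
  for x :: "'a::complex_inner"
  by (induction I rule: infinite_finite_induct) (simp_all add: cinner_add_right)

lemma cinner_sum_left: "cinner (\<Sum>i\<in>I. f i) x = (\<Sum>i\<in>I. cinner (f i) x)"
  for x :: "'a::complex_inner"
  by (induction I rule: infinite_finite_induct) (simp_all add: cinner_add_left)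

lemma cinner_self: "cinner x x = of_real ((norm x)\<^sup>2)" for x :: "'a::complex_inner"
proof -
  have "cinner x x \<in> \<real>"
    by (metis cinner_commute Reals_cnj_iff)
  then show ?thesis
    by (metis Re_cinner of_real_Re power2_norm_eq_inner)
qed

lemma cinner_eqI: "(\<And>z. cinner z x = cinner z y) \<Longrightarrow> x = y" for x y :: "'a::complex_inner"
  using cinner_self[of "x - y"] by (simp add: cinner_diff_right)

lemma norm_scaleC: "norm (a *\<^sub>C x) = cmod a * norm x" for x :: "'a::complex_inner"
proof -
  have "complex_of_real ((norm (a *\<^sub>C x))\<^sup>2) = of_real ((cmod a * norm x)\<^sup>2)"
  proof -
    have "complex_of_real ((norm (a *\<^sub>C x))\<^sup>2) = (a * cnj a) * cinner x x"
      by (subst cinner_self[symmetric]) (simp add: cinner_scaleC_left cinner_scaleC_right)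
    then show ?thesis
      unfolding complex_norm_square[symmetric] cinner_self
      by (simp only: power_mult_distrib flip: of_real_mult)
  qed
  then show ?thesis
    by (metis norm_ge_zero of_real_eq_iff power2_eq_iff_nonneg mult_nonneg_nonneg)
qed

lemma norm_cinner_le: "cmod (cinner x y) \<le> norm x * norm y" for x :: "'a::complex_inner"
proof (cases "cinner x y = 0")
  case False
  define a where "a = sgn (cinner x y)"
  have "cinner (a *\<^sub>C x) y = of_real (cmod (cinner x y))"
  proof -
    have "cinner (a *\<^sub>C x) y = (cinner x y * cnj (cinner x y)) / of_real (cmod (cinner x y))"
      by (simp add: cinner_scaleC_left a_def sgn_eq)
    then show ?thesis
      unfolding complex_norm_square[symmetric] using False by (simp add: power2_eq_square)
  qed
  then have "cmod (cinner x y) = inner (a *\<^sub>C x) y"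
    by (metis Re_cinner Re_complex_of_real)
  also have "\<dots> \<le> norm (a *\<^sub>C x) * norm y"
    by (rule norm_cauchy_schwarz)
  also have "\<dots> = norm x * norm y"
    using False by (simp add: norm_scaleC a_def norm_sgn)
  finally show ?thesis .
qed simp

lemma bounded_bilinear_cinner: "bounded_bilinear (cinner :: 'a::complex_inner \<Rightarrow> 'a \<Rightarrow> complex)"
  by standard
    (auto simp: cinner_add_left cinner_add_right cinner_scaleR_left cinner_scaleR_right
      scaleR_conv_of_real intro!: exI[of _ 1] norm_cinner_le)

lemma bounded_linear_scaleC: "bounded_linear (\<lambda>x::'a::complex_inner. a *\<^sub>C x)"
proof
  show "a *\<^sub>C (r *\<^sub>R x) = r *\<^sub>R a *\<^sub>C x" for r and x :: 'a
    by (metis scaleC_of_real scaleC_scaleC mult.commute)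
  show "\<exists>K. \<forall>x::'a. norm (a *\<^sub>C x) \<le> norm x * K"
    by (intro exI[of _ "cmod a"]) (simp add: norm_scaleC mult.commute)
qed (simp add: scaleC_add_right)

definition selfadjoint_op :: "('a::complex_hilbert \<Rightarrow>\<^sub>L 'a) \<Rightarrow> bool"
  where "selfadjoint_op T \<longleftrightarrow> complex_linear T \<and> (\<forall>x y. cinner x (T y) = cinner (T x) y)"

definition qform :: "('a::complex_hilbert \<Rightarrow>\<^sub>L 'a) \<Rightarrow> 'a \<Rightarrow> real"
  where "qform T x = inner x (T x)"

lemma qform_diff: "qform (A - B) x = qform A x - qform B x"
  by (simp add: qform_def blinfun.diff_left inner_diff_right)

lemma qform_add: "qform (A + B) x = qform A x + qform B x"
  by (simp add: qform_def blinfun.add_left inner_add_right)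

lemma qform_scaleR: "qform (r *\<^sub>R A) x = r * qform A x"
  by (simp add: qform_def blinfun.scaleR_left)

lemma selfadjoint_opD:
  assumes "selfadjoint_op T"
  shows "complex_linear T" "cinner (T x) y = cinner x (T y)" "inner (T x) y = inner x (T y)"
  using assms unfolding selfadjoint_op_def by (auto simp flip: Re_cinner)

lemma complex_linearD: "complex_linear T \<Longrightarrow> T (a *\<^sub>C x) = a *\<^sub>C T x"
  by (simp add: complex_linear_def)

lemma complex_linear_diff: "complex_linear A \<Longrightarrow> complex_linear B \<Longrightarrow> complex_linear (A - B)"
proof -
  have "a *\<^sub>C (x - y) = a *\<^sub>C x - a *\<^sub>C y" for a and x y :: 'a
    using scaleC_add_right[of a "x - y" y] by (simp add: algebra_simps)
  then show "complex_linear A \<Longrightarrow> complex_linear B \<Longrightarrow> complex_linear (A - B)"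
    by (simp add: complex_linear_def blinfun.diff_left)
qed

lemma complex_linear_add: "complex_linear A \<Longrightarrow> complex_linear B \<Longrightarrow> complex_linear (A + B)"
  by (simp add: complex_linear_def blinfun.add_left scaleC_add_right)

lemma complex_linear_scaleR: "complex_linear A \<Longrightarrow> complex_linear (r *\<^sub>R A)"
  by (simp add: complex_linear_def blinfun.scaleR_left)
     (metis scaleC_of_real scaleC_scaleC mult.commute)

lemma selfadjoint_diff: "selfadjoint_op A \<Longrightarrow> selfadjoint_op B \<Longrightarrow> selfadjoint_op (A - B)"
  by (simp add: selfadjoint_op_def complex_linear_diff blinfun.diff_left cinner_diff_left
      cinner_diff_right)

lemma selfadjoint_add: "selfadjoint_op A \<Longrightarrow> selfadjoint_op B \<Longrightarrow> selfadjoint_op (A + B)"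
  by (simp add: selfadjoint_op_def complex_linear_add blinfun.add_left cinner_add_left
      cinner_add_right)

lemma selfadjoint_scaleR: "selfadjoint_op A \<Longrightarrow> selfadjoint_op (r *\<^sub>R A)"
  by (simp add: selfadjoint_op_def complex_linear_scaleR blinfun.scaleR_left cinner_scaleR_left
      cinner_scaleR_right)

lemma selfadjoint_id: "selfadjoint_op id_blinfun"
  by (simp add: selfadjoint_op_def complex_linear_def)

lemma selfadjoint_zero: "selfadjoint_op 0"
  using selfadjoint_scaleR[OF selfadjoint_id, of 0] by simp

lemma selfadjoint_compose:
  assumes "selfadjoint_op A" "selfadjoint_op B" "A o\<^sub>L B = B o\<^sub>L A"
  shows "selfadjoint_op (A o\<^sub>L B)"
proof -
  have "A (B x) = B (A x)" for x
    using assms(3) by (metis blinfun_apply_blinfun_compose)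
  then show ?thesis
    using assms(1,2) by (simp add: selfadjoint_op_def complex_linear_def)
qed

lemma selfadjoint_limit:
  assumes "X \<longlonglongrightarrow> T" "\<And>n. selfadjoint_op (X n)"
  shows "selfadjoint_op T"
proof -
  have lim: "(\<lambda>n. X n x) \<longlonglongrightarrow> T x" for x
    by (intro blinfun.tendsto assms(1) tendsto_const)
  have "T (a *\<^sub>C x) = a *\<^sub>C T x" for a x
  proof (rule LIMSEQ_unique[OF lim])
    show "(\<lambda>n. X n (a *\<^sub>C x)) \<longlonglongrightarrow> a *\<^sub>C T x"
      using bounded_linear.tendsto[OF bounded_linear_scaleC lim] assms(2)
      by (simp add: complex_linearD selfadjoint_opD)
  qed
  moreover have "cinner x (T y) = cinner (T x) y" for x y
  proof (rule LIMSEQ_unique)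
    show "(\<lambda>n. cinner x (X n y)) \<longlonglongrightarrow> cinner x (T y)"
      by (intro bounded_bilinear.tendsto[OF bounded_bilinear_cinner] tendsto_const lim)
    show "(\<lambda>n. cinner x (X n y)) \<longlonglongrightarrow> cinner (T x) y"
      unfolding selfadjoint_opD(2)[OF assms(2), symmetric]
      by (intro bounded_bilinear.tendsto[OF bounded_bilinear_cinner] tendsto_const lim)
  qed
  ultimately show ?thesis
    by (simp add: selfadjoint_op_def complex_linear_def)
qed

lemma selfadjoint_qform: "selfadjoint_op T \<Longrightarrow> cinner x (T x) = of_real (qform T x)"
proof -
  assume T: "selfadjoint_op T"
  have "cnj (cinner x (T x)) = cinner x (T x)"
    by (metis T cinner_commute selfadjoint_opD(2))
  then show ?thesis
    by (metis Re_cinner Reals_cnj_iff of_real_Re qform_def)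
qed

text \<open>
  Over the complex numbers a real quadratic form forces symmetry, by polarization
  with \<open>x + y\<close> and \<open>x + \<i> y\<close>.
\<close>

lemma positive_op_iff: "positive_op T \<longleftrightarrow> selfadjoint_op T \<and> (\<forall>x. qform T x \<ge> 0)"
proof
  assume T: "positive_op T"
  then have lin: "complex_linear T"
    by (simp add: positive_op_def)
  have real: "cinner (T z) z = cinner z (T z)" for z
  proof -
    have "cinner z (T z) \<in> \<real>"
      using T by (auto simp: positive_op_def nonneg_Reals_subset_Reals[THEN subsetD])
    then show ?thesis
      by (metis Reals_cnj_iff cinner_commute)
  qed
  have "cinner x (T y) = cinner (T x) y" for x y
  proof -
    define u where "u = cinner x (T y) - cinner (T x) y"
    define v where "v = cinner y (T x) - cinner (T y) x"
    have "u + v = 0"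
      using real[of "x + y"] real[of x] real[of y]
      by (simp add: u_def v_def blinfun.add_right cinner_add_left cinner_add_right algebra_simps)
    moreover have "\<i> * u - \<i> * v = 0"
      using real[of "x + \<i> *\<^sub>C y"] real[of x] real[of y]
      by (simp add: u_def v_def blinfun.add_right complex_linearD[OF lin] cinner_add_left
          cinner_add_right cinner_scaleC_left cinner_scaleC_right algebra_simps)
    ultimately have "u = 0"
      by (metis add_cancel_right_left add_eq_0_iff complex_i_not_zero diff_0_right eq_iff_diff_eq_0
          mult_cancel_left mult_2 mult_eq_0_iff zero_neq_numeral)
    then show ?thesis
      by (simp add: u_def)
  qed
  moreover have "qform T x \<ge> 0" for x
    using T by (auto simp: positive_op_def qform_def complex_nonneg_Reals_iff simp flip: Re_cinner)
  ultimately show "selfadjoint_op T \<and> (\<forall>x. qform T x \<ge> 0)"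
    using lin by (simp add: selfadjoint_op_def)
next
  assume "selfadjoint_op T \<and> (\<forall>x. qform T x \<ge> 0)"
  then show "positive_op T"
    by (simp add: positive_op_def selfadjoint_qform selfadjoint_opD)
qed

lemma positive_add: "positive_op A \<Longrightarrow> positive_op B \<Longrightarrow> positive_op (A + B)"
  by (simp add: positive_op_iff selfadjoint_add qform_add)

lemma positive_scaleR: "positive_op A \<Longrightarrow> r \<ge> 0 \<Longrightarrow> positive_op (r *\<^sub>R A)"
  by (simp add: positive_op_iff selfadjoint_scaleR qform_scaleR)

lemma positive_square:
  assumes "selfadjoint_op X"
  shows "positive_op (X o\<^sub>L X)"
proof -
  have "qform (X o\<^sub>L X) x = inner (X x) (X x)" for x
    by (simp add: qform_def selfadjoint_opD(3)[OF assms])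
  then show ?thesis
    using selfadjoint_compose[OF assms assms refl] by (simp add: positive_op_iff)
qed

text \<open>
  The Cauchy-Schwarz inequality for the semi-inner product \<open>\<langle>u, T v\<rangle>\<close>, applied to \<open>x\<close> and \<open>T x\<close>.
\<close>

lemma positive_norm_sq_le:
  assumes T: "positive_op T"
  shows "(norm (T x))\<^sup>2 \<le> norm T * qform T x"
proof -
  define a where "a = qform T x"
  define b where "b = (norm (T x))\<^sup>2"
  define c where "c = qform T (T x)"
  have sym: "inner (T u) v = inner u (T v)" for u v
    using T by (simp add: positive_op_iff selfadjoint_opD)
  have b: "inner x (T (T x)) = b" "inner (T x) (T x) = b"
    by (simp_all add: b_def power2_norm_eq_inner flip: sym)
  have quad: "0 \<le> a + 2 * s * b + s\<^sup>2 * c" for s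
  proof -
    have "qform T (x + s *\<^sub>R T x) = a + 2 * s * b + s\<^sup>2 * c"
      by (simp add: a_def c_def qform_def blinfun.add_right blinfun.scaleR_right
          inner_add_left inner_add_right b algebra_simps power2_eq_square)
    then show ?thesis
      using T by (metis positive_op_iff)
  qed
  have "c \<le> norm (T x) * norm (T (T x))"
    unfolding c_def qform_def by (rule norm_cauchy_schwarz)
  also have "\<dots> \<le> norm (T x) * (norm T * norm (T x))"
    by (intro mult_left_mono norm_blinfun) auto
  finally have c: "c \<le> norm T * b"
    by (simp add: b_def power2_eq_square mult.assoc mult.left_commute)
  have "b \<le> norm T * a"
  proof (cases "norm T = 0")
    case False
    then have pos: "norm T > 0" by simp
    \<comment> \<open>At \<open>s = -1 / \<parallel>T\<parallel>\<close> the bound for the quadratic term cancels half of the linear one.\<close>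
    have "0 \<le> a + 2 * (- 1 / norm T) * b + (- 1 / norm T)\<^sup>2 * (norm T * b)"
      using quad[of "- 1 / norm T"] mult_left_mono[OF c, of "(- 1 / norm T)\<^sup>2"] by simp
    also have "\<dots> = a - b / norm T"
      using pos by (simp add: power2_eq_square field_simps)
    finally show ?thesis
      using pos by (simp add: field_simps)
  qed (simp add: b_def)
  then show ?thesis
    by (simp add: a_def b_def)
qed

lemma positive_qform_eq_0: "positive_op T \<Longrightarrow> qform T x = 0 \<Longrightarrow> T x = 0"
  using positive_norm_sq_le[of T x] by simp

section \<open>Square roots and absolute values\<close>

text \<open>
  If the sequence converges to \<open>Y\<close>, then \<open>2 Y = B + Y\<^sup>2\<close>, that is, \<open>(1 - Y)\<^sup>2 = 1 - B\<close>. All iterates are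
  polynomials in \<open>B\<close> with nonnegative coefficients, so for \<open>\<parallel>B\<parallel> \<le> 1\<close> norms are dominated by the
  same iteration at the scalar \<open>1\<close>.
\<close>

primrec sqrt_iter :: "('a::complex_hilbert \<Rightarrow>\<^sub>L 'a) \<Rightarrow> nat \<Rightarrow> ('a \<Rightarrow>\<^sub>L 'a)"
  where "sqrt_iter B 0 = 0"
  | "sqrt_iter B (Suc n) = (1/2) *\<^sub>R (B + (sqrt_iter B n o\<^sub>L sqrt_iter B n))"

primrec sqrt_iter_bound :: "nat \<Rightarrow> real"
  where "sqrt_iter_bound 0 = 0"
  | "sqrt_iter_bound (Suc n) = (1 + (sqrt_iter_bound n)\<^sup>2) / 2"

lemma sqrt_iter_bound_le_1: "0 \<le> sqrt_iter_bound n" "sqrt_iter_bound n \<le> 1"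
  by (induction n) (simp_all add: power_le_one)

lemma sqrt_iter_commute:
  fixes B C :: "'a::complex_hilbert \<Rightarrow>\<^sub>L 'a"
  assumes "\<And>x. C (B x) = B (C x)"
  shows "C (sqrt_iter B n x) = sqrt_iter B n (C x)"
  by (induction n arbitrary: x) (simp_all add: blinfun.bilinear_simps assms)

lemma sqrt_iter_commute_self: "sqrt_iter B m (sqrt_iter B n x) = sqrt_iter B n (sqrt_iter B m x)"
proof (rule sqrt_iter_commute)
  show "sqrt_iter B m (B y) = B (sqrt_iter B m y)" for y
    by (rule sqrt_iter_commute[symmetric]) simp
qed

lemma selfadjoint_sqrt_iter: "selfadjoint_op B \<Longrightarrow> selfadjoint_op (sqrt_iter B n)"
  by (induction n)
    (simp_all add: selfadjoint_zero selfadjoint_scaleR selfadjoint_add selfadjoint_compose)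

lemma norm_sqrt_iter_le:
  assumes "norm B \<le> 1"
  shows "norm (sqrt_iter B n) \<le> sqrt_iter_bound n"
proof (induction n)
  case (Suc n)
  have "norm (B + (sqrt_iter B n o\<^sub>L sqrt_iter B n))
      \<le> norm B + norm (sqrt_iter B n) * norm (sqrt_iter B n)"
    by (rule norm_triangle_le[OF add_left_mono[OF norm_blinfun_compose]])
  also have "\<dots> \<le> 1 + (sqrt_iter_bound n)\<^sup>2"
    unfolding power2_eq_square
    by (intro add_mono mult_mono assms Suc.IH) (simp_all add: sqrt_iter_bound_le_1)
  finally show ?case
    by simp
qed simp

text \<open>
  The increment is \<open>(Y\<^sub>1 - Y\<^sub>0) (Y\<^sub>1 + Y\<^sub>0) / 2\<close> because iterates commute, and the scalar increments
  satisfy the same identity. The scalar sequence increases to a limit, so convergence of the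
  operators holds in norm, without any spectral theory.
\<close>

lemma norm_sqrt_iter_step:
  assumes "norm B \<le> 1"
  shows "norm (sqrt_iter B (Suc n) - sqrt_iter B n) \<le> sqrt_iter_bound (Suc n) - sqrt_iter_bound n"
proof (induction n)
  case 0
  show ?case using assms by simp
next
  case (Suc n)
  let ?Y = "sqrt_iter B" and ?y = sqrt_iter_bound
  have "?Y (Suc (Suc n)) - ?Y (Suc n)
      = (1/2) *\<^sub>R ((?Y (Suc n) - ?Y n) o\<^sub>L (?Y (Suc n) + ?Y n))"
  proof (rule blinfun_eqI)
    fix x
    have "(?Y (Suc (Suc n)) - ?Y (Suc n)) x
        = (1/2) *\<^sub>R (?Y (Suc n) (?Y (Suc n) x) - ?Y n (?Y n x))"
      by (subst (1 2) sqrt_iter.simps(2))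
        (simp add: blinfun.bilinear_simps scaleR_diff_right scaleR_add_right
          del: sqrt_iter.simps)
    also have "\<dots> = ((1/2) *\<^sub>R ((?Y (Suc n) - ?Y n) o\<^sub>L (?Y (Suc n) + ?Y n))) x"
      using sqrt_iter_commute_self[of B n "Suc n" x]
      by (simp add: blinfun.bilinear_simps del: sqrt_iter.simps)
    finally show "(?Y (Suc (Suc n)) - ?Y (Suc n)) x = \<dots>" .
  qed
  then have "norm (?Y (Suc (Suc n)) - ?Y (Suc n))
      = norm ((?Y (Suc n) - ?Y n) o\<^sub>L (?Y (Suc n) + ?Y n)) / 2"
    by simp
  also have "\<dots> \<le> (norm (?Y (Suc n) - ?Y n) * norm (?Y (Suc n) + ?Y n)) / 2"
    by (intro divide_right_mono norm_blinfun_compose) simp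
  also have "\<dots> \<le> ((?y (Suc n) - ?y n) * (?y (Suc n) + ?y n)) / 2"
  proof -
    have "norm (?Y (Suc n) + ?Y n) \<le> ?y (Suc n) + ?y n"
      using norm_sqrt_iter_le[OF assms, of n] norm_sqrt_iter_le[OF assms, of "Suc n"]
        norm_triangle_ineq[of "?Y (Suc n)" "?Y n"] by linarith
    moreover have "0 \<le> ?y (Suc n) - ?y n"
      using Suc.IH norm_ge_zero order_trans by blast
    ultimately show ?thesis
      by (intro divide_right_mono mult_mono Suc.IH) auto
  qed
  also have "\<dots> = ?y (Suc (Suc n)) - ?y (Suc n)"
    by (subst (3 4) sqrt_iter_bound.simps(2))
      (simp add: algebra_simps power2_eq_square diff_divide_distrib del: sqrt_iter_bound.simps)
  finally show ?case .
qed

lemma convergent_sqrt_iter: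
  assumes "norm B \<le> 1"
  shows "convergent (sqrt_iter B)"
proof -
  let ?Y = "sqrt_iter B" and ?y = sqrt_iter_bound
  have step: "0 \<le> ?y (Suc n) - ?y n" for n
    using norm_sqrt_iter_step[OF assms, of n] norm_ge_zero order_trans by blast
  then have "incseq ?y"
    by (intro incseq_SucI) (simp del: sqrt_iter_bound.simps)
  have dist: "norm (?Y (n + k) - ?Y n) \<le> ?y (n + k) - ?y n" for n k
  proof (induction k)
    case (Suc k)
    have "?Y (n + Suc k) - ?Y n = (?Y (Suc (n + k)) - ?Y (n + k)) + (?Y (n + k) - ?Y n)"
      by (simp del: sqrt_iter.simps)
    then have "norm (?Y (n + Suc k) - ?Y n)
        \<le> norm (?Y (Suc (n + k)) - ?Y (n + k)) + norm (?Y (n + k) - ?Y n)"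
      by (metis norm_triangle_ineq)
    then show ?case
      using norm_sqrt_iter_step[OF assms, of "n + k"] Suc.IH by simp
  qed simp
  have "convergent ?y"
    by (rule Bseq_mono_convergent[OF BseqI'[of _ 1]])
      (use sqrt_iter_bound_le_1 \<open>incseq ?y\<close> in \<open>auto simp: incseq_def\<close>)
  then have "Cauchy ?y"
    by (rule convergent_Cauchy)
  have "Cauchy ?Y"
  proof (rule metric_CauchyI)
    fix e :: real assume "e > 0"
    then obtain M where M: "\<And>m n. m \<ge> M \<Longrightarrow> n \<ge> M \<Longrightarrow> dist (?y m) (?y n) < e"
      using metric_CauchyD[OF \<open>Cauchy ?y\<close>] by blast
    have *: "dist (?Y m) (?Y n) < e" if "n \<ge> M" "m \<ge> n" for m n
    proof -
      have "dist (?Y m) (?Y n) \<le> ?y m - ?y n"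
        using dist[of n "m - n"] that by (simp add: dist_norm)
      also have "\<dots> \<le> dist (?y m) (?y n)"
        by (simp add: dist_real_def)
      finally show ?thesis
        using M[of m n] that by linarith
    qed
    have "dist (?Y m) (?Y n) < e" if "m \<ge> M" "n \<ge> M" for m n
      using *[of m n] *[of n m] that by (cases "m \<ge> n") (auto simp: dist_commute)
    then show "\<exists>M. \<forall>m\<ge>M. \<forall>n\<ge>M. dist (?Y m) (?Y n) < e"
      by blast
  qed
  then show ?thesis
    by (rule Cauchy_convergent)
qed

text \<open>
  The iteration for \<open>B = 1 - T\<close>. The root is a limit of polynomials in \<open>T\<close>, hence commutes with
  everything that commutes with \<open>T\<close>; uniqueness of the root depends on this.
\<close>

lemma contraction_sqrt_exists:
  fixes T :: "'a::complex_hilbert \<Rightarrow>\<^sub>L 'a"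
  assumes T: "positive_op T" and "norm T \<le> 1"
  shows "\<exists>R. positive_op R \<and> R o\<^sub>L R = T \<and>
    (\<forall>C::'a \<Rightarrow>\<^sub>L 'a. (\<forall>x. C (T x) = T (C x)) \<longrightarrow> (\<forall>x. C (R x) = R (C x)))"
proof -
  define B where "B = id_blinfun - T"
  have sa: "selfadjoint_op B"
    using T by (simp add: B_def selfadjoint_diff selfadjoint_id positive_op_iff)
  have "norm B \<le> 1"
  proof (rule norm_blinfun_bound)
    fix x
    have "(norm (B x))\<^sup>2 = (norm x)\<^sup>2 - 2 * qform T x + (norm (T x))\<^sup>2"
      by (simp add: B_def blinfun.diff_left power2_norm_eq_inner qform_def inner_diff_left
          inner_diff_right inner_commute)
    moreover have "norm T * qform T x \<le> 1 * qform T x"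
      using assms by (intro mult_right_mono) (auto simp: positive_op_iff)
    moreover have "qform T x \<ge> 0"
      using T by (simp add: positive_op_iff)
    ultimately have "(norm (B x))\<^sup>2 \<le> (norm x)\<^sup>2"
      using positive_norm_sq_le[OF T, of x] by linarith
    then show "norm (B x) \<le> 1 * norm x"
      using power2_le_imp_le[of "norm (B x)" "norm x"] by simp
  qed simp
  then obtain Y where lim: "sqrt_iter B \<longlonglongrightarrow> Y"
    using convergent_sqrt_iter convergent_def by blast
  have "norm Y \<le> 1"
  proof (rule LIMSEQ_le_const2[OF tendsto_norm[OF lim]])
    show "\<exists>N. \<forall>n\<ge>N. norm (sqrt_iter B n) \<le> 1"
      using norm_sqrt_iter_le[OF \<open>norm B \<le> 1\<close>] sqrt_iter_bound_le_1 order_trans by blast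
  qed
  have "Y = (1/2) *\<^sub>R (B + (Y o\<^sub>L Y))"
  proof (rule LIMSEQ_unique)
    show "(\<lambda>n. sqrt_iter B (Suc n)) \<longlonglongrightarrow> Y"
      by (rule LIMSEQ_Suc[OF lim])
    show "(\<lambda>n. sqrt_iter B (Suc n)) \<longlonglongrightarrow> (1/2) *\<^sub>R (B + (Y o\<^sub>L Y))"
      unfolding sqrt_iter.simps
      by (intro tendsto_intros bounded_bilinear.tendsto[OF bounded_bilinear_blinfun_compose] lim)
  qed
  then have Y2: "Y (Y x) = 2 *\<^sub>R Y x - x + T x" for x
  proof -
    have "2 *\<^sub>R Y = B + (Y o\<^sub>L Y)"
      using \<open>Y = (1/2) *\<^sub>R (B + (Y o\<^sub>L Y))\<close>
      by (metis (no_types) field_sum_of_halves scaleR_2 scaleR_left_distrib scaleR_one)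
    then have "2 *\<^sub>R Y x = B x + Y (Y x)"
      by (metis blinfun.add_left blinfun.scaleR_left blinfun_apply_blinfun_compose)
    then show ?thesis
      by (simp add: B_def blinfun.diff_left)
  qed
  define R where "R = id_blinfun - Y"
  have "R o\<^sub>L R = T"
    by (rule blinfun_eqI) (simp add: R_def blinfun.bilinear_simps Y2 scaleR_2)
  moreover have "positive_op R"
  proof -
    have "selfadjoint_op R"
      unfolding R_def
      by (intro selfadjoint_diff selfadjoint_id selfadjoint_limit[OF lim] selfadjoint_sqrt_iter sa)
    moreover have "qform R x \<ge> 0" for x
    proof -
      have "inner x (Y x) \<le> norm x * norm (Y x)"
        by (rule norm_cauchy_schwarz)
      also have "\<dots> \<le> norm x * (norm Y * norm x)"
        by (intro mult_left_mono norm_blinfun) simp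
      also have "\<dots> \<le> norm x * (1 * norm x)"
        using \<open>norm Y \<le> 1\<close> by (intro mult_left_mono mult_right_mono) auto
      finally show ?thesis
        by (simp add: R_def qform_def blinfun.diff_left inner_diff_right dot_square_norm
            power2_eq_square)
    qed
    ultimately show ?thesis
      by (simp add: positive_op_iff)
  qed
  moreover have "C (R x) = R (C x)" if C: "\<And>x. C (T x) = T (C x)" for C :: "'a \<Rightarrow>\<^sub>L 'a" and x
  proof -
    have "C (Y x) = Y (C x)"
    proof (rule LIMSEQ_unique)
      show "(\<lambda>n. C (sqrt_iter B n x)) \<longlonglongrightarrow> C (Y x)"
        by (intro blinfun.tendsto lim tendsto_const)
      have "C (sqrt_iter B n x) = sqrt_iter B n (C x)" for n
        by (rule sqrt_iter_commute) (simp add: B_def blinfun.bilinear_simps C)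
      then show "(\<lambda>n. C (sqrt_iter B n x)) \<longlonglongrightarrow> Y (C x)"
        using blinfun.tendsto[OF lim tendsto_const[of "C x"]] by simp
    qed
    then show ?thesis
      by (simp add: R_def blinfun.bilinear_simps)
  qed
  ultimately show ?thesis
    by blast
qed

lemma positive_sqrt_exists:
  fixes T :: "'a::complex_hilbert \<Rightarrow>\<^sub>L 'a"
  assumes T: "positive_op T"
  shows "\<exists>R. positive_op R \<and> R o\<^sub>L R = T \<and>
    (\<forall>C::'a \<Rightarrow>\<^sub>L 'a. (\<forall>x. C (T x) = T (C x)) \<longrightarrow> (\<forall>x. C (R x) = R (C x)))"
proof (cases "T = 0")
  case True
  then show ?thesis
    using T by (intro exI[of _ 0]) simp
next
  case False
  define c where "c = norm T"
  have c: "c > 0"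
    using False by (simp add: c_def)
  have "positive_op (inverse c *\<^sub>R T)" "norm (inverse c *\<^sub>R T) \<le> 1"
    using T c by (auto intro!: positive_scaleR simp: c_def)
  then obtain R where R: "positive_op R" "R o\<^sub>L R = inverse c *\<^sub>R T"
    and comm: "\<forall>C::'a \<Rightarrow>\<^sub>L 'a. (\<forall>x. C ((inverse c *\<^sub>R T) x) = (inverse c *\<^sub>R T) (C x))
      \<longrightarrow> (\<forall>x. C (R x) = R (C x))"
    using contraction_sqrt_exists by blast
  show ?thesis
  proof (intro exI[of _ "sqrt c *\<^sub>R R"] conjI allI impI)
    show "positive_op (sqrt c *\<^sub>R R)"
      using R c by (simp add: positive_scaleR)
    show "(sqrt c *\<^sub>R R) o\<^sub>L (sqrt c *\<^sub>R R) = T"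
    proof (rule blinfun_eqI)
      fix x
      have "R (R x) = inverse c *\<^sub>R T x"
        by (metis R(2) blinfun.scaleR_left blinfun_apply_blinfun_compose)
      moreover have "sqrt c * (sqrt c * inverse c) = 1"
        using c by (simp flip: mult.assoc)
      ultimately show "((sqrt c *\<^sub>R R) o\<^sub>L (sqrt c *\<^sub>R R)) x = T x"
        by (simp add: blinfun.bilinear_simps)
    qed
    show "C ((sqrt c *\<^sub>R R) x) = (sqrt c *\<^sub>R R) (C x)"
      if "\<forall>x. C (T x) = T (C x)" for C :: "'a \<Rightarrow>\<^sub>L 'a" and x
      using comm that by (simp add: blinfun.bilinear_simps)
  qed
qed

text \<open>
  Both roots commute with their common square, hence with the root \<open>S\<close> constructed above, so it is
  enough to compare two commuting roots \<open>Q\<close> and \<open>R'\<close>. There \<open>(Q + R') (Q - R') = 0\<close>, so both forms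
  vanish at \<open>y = (Q - R') x\<close>, and then so do \<open>Q y\<close> and \<open>R' y\<close>.
\<close>

lemma positive_sqrt_unique:
  fixes P R :: "'a::complex_hilbert \<Rightarrow>\<^sub>L 'a"
  assumes P: "positive_op P" and R: "positive_op R" and eq: "P o\<^sub>L P = R o\<^sub>L R"
  shows "P = R"
proof -
  have unique: "Q = R'"
    if Q: "positive_op Q" and R': "positive_op R'" and sq: "Q o\<^sub>L Q = R' o\<^sub>L R'"
      and comm: "\<And>x. Q (R' x) = R' (Q x)" for Q R' :: "'a \<Rightarrow>\<^sub>L 'a"
  proof (rule blinfun_eqI)
    fix x
    define y where "y = Q x - R' x"
    have "Q (Q x) = R' (R' x)"
      by (metis sq blinfun_apply_blinfun_compose)
    then have "Q y + R' y = 0"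
      by (simp add: y_def blinfun.bilinear_simps comm)
    then have "qform Q y + qform R' y = 0"
      by (simp add: qform_def flip: inner_add_right)
    then have "qform Q y = 0" "qform R' y = 0"
      using Q R' by (simp_all add: positive_op_iff add_nonneg_eq_0_iff)
    then have "Q y = 0" "R' y = 0"
      using positive_qform_eq_0 Q R' by blast+
    moreover have "inner y y = inner x (Q y - R' y)"
      using Q R'
      by (simp add: y_def positive_op_iff selfadjoint_opD inner_diff_left inner_diff_right
          blinfun.diff_right)
    ultimately show "Q x = R' x"
      by (simp add: y_def)
  qed
  obtain S where S: "positive_op S" "S o\<^sub>L S = P o\<^sub>L P"
    and comm: "\<forall>C::'a \<Rightarrow>\<^sub>L 'a. (\<forall>x. C ((P o\<^sub>L P) x) = (P o\<^sub>L P) (C x)) \<longrightarrow> (\<forall>x. C (S x) = S (C x))"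
    using positive_sqrt_exists[OF positive_square[of P]] P unfolding positive_op_iff by blast
  have PP: "(P o\<^sub>L P) x = P (P x)" "(P o\<^sub>L P) x = R (R x)" for x
    by (rule blinfun_apply_blinfun_compose) (simp only: eq blinfun_apply_blinfun_compose)
  have "P = S"
  proof (rule unique)
    show "P (S x) = S (P x)" for x
      by (rule comm[rule_format]) (simp only: PP(1))
  qed (use P S in simp_all)
  moreover have "R = S"
  proof (rule unique)
    show "R (S x) = S (R x)" for x
      by (rule comm[rule_format]) (simp only: PP(2))
  qed (use R S eq in simp_all)
  ultimately show ?thesis
    by simp
qed

lemma adjoint_op_selfadjoint:
  assumes "selfadjoint_op X"
  shows "adjoint_op X = X"
  unfolding adjoint_op_def
proof (rule the_equality)
  show "\<forall>x y. cinner (X x) y = cinner x (X y)"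
    using assms by (simp add: selfadjoint_opD)
next
  fix U assume U: "\<forall>x y. cinner (blinfun_apply U x) y = cinner x (X y)"
  show "U = X"
  proof (rule blinfun_eqI, rule cinner_eqI)
    fix x z
    show "cinner z (U x) = cinner z (X x)"
      using U assms by (metis cinner_commute selfadjoint_opD(2))
  qed
qed

lemma abs_op_eqI:
  assumes "selfadjoint_op X" "positive_op P" "P o\<^sub>L P = X o\<^sub>L X"
  shows "abs_op X = P"
  unfolding abs_op_def adjoint_op_selfadjoint[OF assms(1)]
proof (rule the_equality)
  show "Q = P" if "positive_op Q \<and> Q o\<^sub>L Q = X o\<^sub>L X" for Q
    by (rule positive_sqrt_unique) (use that assms in auto)
qed (use assms in simp)

lemma abs_op_positive: "positive_op T \<Longrightarrow> abs_op T = T"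
  by (rule abs_op_eqI) (simp_all add: positive_op_iff)

lemma abs_op_selfadjoint:
  fixes X :: "'a::complex_hilbert \<Rightarrow>\<^sub>L 'a"
  assumes X: "selfadjoint_op X"
  shows "positive_op (abs_op X)" "abs_op X (abs_op X x) = X (X x)"
    "X (abs_op X x) = abs_op X (X x)"
proof -
  obtain P where P: "positive_op P" "P o\<^sub>L P = X o\<^sub>L X"
    and comm: "\<forall>C::'a \<Rightarrow>\<^sub>L 'a. (\<forall>x. C ((X o\<^sub>L X) x) = (X o\<^sub>L X) (C x)) \<longrightarrow> (\<forall>x. C (P x) = P (C x))"
    using positive_sqrt_exists[OF positive_square[OF X]] by blast
  have abs: "abs_op X = P"
    by (rule abs_op_eqI[OF X P])
  show "positive_op (abs_op X)"
    by (simp add: abs P)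
  show "abs_op X (abs_op X x) = X (X x)"
    by (metis abs P(2) blinfun_apply_blinfun_compose)
  show "X (abs_op X x) = abs_op X (X x)"
    by (simp add: abs comm)
qed

section \<open>Orthonormal sets and the trace of a positive operator\<close>

definition orthonormal_set :: "'a::complex_inner set \<Rightarrow> bool"
  where "orthonormal_set B \<longleftrightarrow> (\<forall>e\<in>B. \<forall>f\<in>B. cinner e f = (if e = f then 1 else 0))"

definition closed_csubspace :: "'a::complex_hilbert set \<Rightarrow> bool"
  where "closed_csubspace K \<longleftrightarrow> closed K \<and> 0 \<in> K \<and> (\<forall>x\<in>K. \<forall>y\<in>K. x + y \<in> K) \<and>
    (\<forall>a. \<forall>x\<in>K. a *\<^sub>C x \<in> K)"

lemma closed_csubspace_UNIV: "closed_csubspace UNIV"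
  by (simp add: closed_csubspace_def)

lemma closed_csubspace_scaleR: "closed_csubspace K \<Longrightarrow> x \<in> K \<Longrightarrow> r *\<^sub>R x \<in> K"
  by (metis closed_csubspace_def scaleC_of_real)

lemma closed_csubspace_diff: "closed_csubspace K \<Longrightarrow> x \<in> K \<Longrightarrow> y \<in> K \<Longrightarrow> x - y \<in> K"
  using closed_csubspace_scaleR[of K y "-1"] unfolding closed_csubspace_def
  by (metis diff_conv_add_uminus scaleR_minus1_left)

lemma closed_csubspace_sum:
  assumes "closed_csubspace K" "\<And>i. i \<in> I \<Longrightarrow> f i \<in> K"
  shows "(\<Sum>i\<in>I. c i *\<^sub>C f i) \<in> K"
  using assms(2)
  by (induction I rule: infinite_finite_induct)
    (use assms(1) in \<open>auto simp: closed_csubspace_def\<close>)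

lemma orthonormal_set_empty [simp]: "orthonormal_set {}"
  by (simp add: orthonormal_set_def)

lemma orthonormal_set_subset: "orthonormal_set B \<Longrightarrow> A \<subseteq> B \<Longrightarrow> orthonormal_set A"
  unfolding orthonormal_set_def by blast

lemma orthonormal_set_norm: "orthonormal_set B \<Longrightarrow> e \<in> B \<Longrightarrow> norm e = 1"
  by (metis Re_cinner norm_eq_1 one_complex.simps(1) orthonormal_set_def)

lemma orthonormal_set_Un:
  assumes "orthonormal_set A" "orthonormal_set B" "\<And>a b. a \<in> A \<Longrightarrow> b \<in> B \<Longrightarrow> cinner a b = 0"
  shows "orthonormal_set (A \<union> B)"
proof -
  have "cinner b a = 0" if "a \<in> A" "b \<in> B" for a b
    using assms(3)[OF that] by (metis cinner_commute complex_cnj_zero)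
  moreover have "a \<noteq> b" if "a \<in> A" "b \<in> B" for a b
    using assms(3)[OF that] assms(1) that by (auto simp: orthonormal_set_def)
  ultimately show ?thesis
    using assms unfolding orthonormal_set_def by (auto; metis)
qed

text \<open>
  Zorn's lemma inside a closed subspace \<open>K\<close>. Besides bases of the whole space this provides bases
  of \<open>K\<close>, which are needed to project onto \<open>K\<close>.
\<close>

lemma orthonormal_extend:
  assumes K: "closed_csubspace K" and F: "orthonormal_set F" "F \<subseteq> K"
  shows "\<exists>B. F \<subseteq> B \<and> B \<subseteq> K \<and> orthonormal_set B \<and> (\<forall>x\<in>K. (\<forall>e\<in>B. cinner e x = 0) \<longrightarrow> x = 0)"
proof -
  define \<A> where "\<A> = {B. F \<subseteq> B \<and> B \<subseteq> K \<and> orthonormal_set B}"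
  have "\<exists>M\<in>\<A>. \<forall>X\<in>\<A>. M \<subseteq> X \<longrightarrow> X = M"
  proof (rule subset_Zorn_nonempty)
    show "\<A> \<noteq> {}"
      using F by (auto simp: \<A>_def)
  next
    fix \<C> assume \<C>: "\<C> \<noteq> {}" "subset.chain \<A> \<C>"
    then have sub: "\<C> \<subseteq> \<A>" and chain: "\<And>X Y. X \<in> \<C> \<Longrightarrow> Y \<in> \<C> \<Longrightarrow> X \<subseteq> Y \<or> Y \<subseteq> X"
      by (auto simp: subset.chain_def)
    have "cinner e f = (if e = f then 1 else 0)" if "e \<in> \<Union>\<C>" "f \<in> \<Union>\<C>" for e f
    proof -
      obtain X Y where "X \<in> \<C>" "e \<in> X" "Y \<in> \<C>" "f \<in> Y"
        using \<open>e \<in> \<Union>\<C>\<close> \<open>f \<in> \<Union>\<C>\<close> by blast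
      then obtain X where "X \<in> \<C>" "e \<in> X" "f \<in> X"
        using chain[of X Y] by blast
      then show ?thesis
        using sub by (auto simp: \<A>_def orthonormal_set_def)
    qed
    then have "orthonormal_set (\<Union>\<C>)"
      by (simp only: orthonormal_set_def) blast
    moreover have "F \<subseteq> \<Union>\<C>" "\<Union>\<C> \<subseteq> K"
      using \<C>(1) sub by (auto simp: \<A>_def)
    ultimately show "\<Union>\<C> \<in> \<A>"
      by (simp add: \<A>_def)
  qed
  then obtain B where B: "F \<subseteq> B" "B \<subseteq> K" "orthonormal_set B"
    and max: "\<And>X. X \<in> \<A> \<Longrightarrow> B \<subseteq> X \<Longrightarrow> X = B"
    by (auto simp: \<A>_def)
  have "x = 0" if x: "x \<in> K" "\<forall>e\<in>B. cinner e x = 0" for x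
  proof (rule ccontr)
    assume "x \<noteq> 0"
    define u where "u = inverse (norm x) *\<^sub>R x"
    have "norm u = 1"
      using \<open>x \<noteq> 0\<close> by (simp add: u_def)
    have orth: "cinner e u = 0" if "e \<in> B" for e
      using x(2) that by (simp add: u_def cinner_scaleR_right)
    have "orthonormal_set (B \<union> {u})"
      using B(3) \<open>norm u = 1\<close> orth
      by (intro orthonormal_set_Un) (auto simp: orthonormal_set_def cinner_self)
    moreover have "u \<in> K"
      using closed_csubspace_scaleR[OF K x(1)] by (simp add: u_def)
    ultimately have "B \<union> {u} \<in> \<A>"
      using B by (auto simp: \<A>_def)
    then have "u \<in> B"
      using max by blast
    then show False
      using orth[of u] \<open>norm u = 1\<close> by (simp add: cinner_self)
  qed
  then show ?thesis
    using B by blast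
qed

lemma orthonormal_basis_iff:
  "orthonormal_basis B \<longleftrightarrow> orthonormal_set B \<and> (\<forall>x. (\<forall>e\<in>B. cinner e x = 0) \<longrightarrow> x = 0)"
  by (simp add: orthonormal_basis_def orthonormal_set_def)

lemma orthonormal_basis_extend:
  assumes "orthonormal_set F"
  obtains B where "F \<subseteq> B" "orthonormal_basis B"
  using orthonormal_extend[OF closed_csubspace_UNIV assms] unfolding orthonormal_basis_iff by auto

lemma cinner_orthonormal_sum:
  assumes "finite F" "orthonormal_set F" "e \<in> F"
  shows "cinner e (\<Sum>f\<in>F. c f *\<^sub>C f) = c e"
proof -
  have "cinner e (\<Sum>f\<in>F. c f *\<^sub>C f) = (\<Sum>f\<in>F. if e = f then c f else 0)"
    unfolding cinner_sum_right cinner_scaleC_right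
    by (rule sum.cong) (use assms in \<open>auto simp: orthonormal_set_def\<close>)
  then show ?thesis
    using assms by simp
qed

lemma norm_orthonormal_sum:
  assumes "finite F" "orthonormal_set F"
  shows "(norm (\<Sum>e\<in>F. c e *\<^sub>C e))\<^sup>2 = (\<Sum>e\<in>F. (cmod (c e))\<^sup>2)"
proof -
  have "complex_of_real ((norm (\<Sum>e\<in>F. c e *\<^sub>C e))\<^sup>2)
      = (\<Sum>e\<in>F. cnj (c e) * cinner e (\<Sum>e\<in>F. c e *\<^sub>C e))"
    unfolding cinner_self[symmetric] by (subst cinner_sum_left) (simp add: cinner_scaleC_left)
  also have "\<dots> = (\<Sum>e\<in>F. of_real ((cmod (c e))\<^sup>2))"
    by (rule sum.cong) (simp_all only: cinner_orthonormal_sum[OF assms] complex_norm_square mult.commute)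
  also have "\<dots> = of_real (\<Sum>e\<in>F. (cmod (c e))\<^sup>2)"
    by simp
  finally show ?thesis
    by (simp only: of_real_eq_iff)
qed

text \<open>
  For a finite orthonormal set this is the orthogonal projection onto its span; for infinite sets
  the sum, and with it the operator, is \<open>0\<close>.
\<close>

definition proj_op :: "'a::complex_hilbert set \<Rightarrow> ('a \<Rightarrow>\<^sub>L 'a)"
  where "proj_op F = (\<Sum>e\<in>F. Blinfun (\<lambda>x. cinner e x *\<^sub>C e))"

lemma proj_op_apply: "proj_op F x = (\<Sum>e\<in>F. cinner e x *\<^sub>C e)"
proof -
  have "bounded_linear (\<lambda>x. cinner e x *\<^sub>C e)" for e :: 'a
  proof (intro bounded_linear_intro[where K = "norm e * norm e"])
    show "norm (cinner e x *\<^sub>C e) \<le> norm x * (norm e * norm e)" for x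
      using mult_right_mono[OF norm_cinner_le[of e x], of "norm e"]
      by (simp add: norm_scaleC mult_ac)
    show "cinner e (x + y) *\<^sub>C e = cinner e x *\<^sub>C e + cinner e y *\<^sub>C e" for x y
      by (simp add: cinner_add_right scaleC_add_left)
    show "cinner e (r *\<^sub>R x) *\<^sub>C e = r *\<^sub>R cinner e x *\<^sub>C e" for r x
      by (metis cinner_scaleR_right scaleC_of_real scaleC_scaleC)
  qed
  then show ?thesis
    by (simp add: proj_op_def blinfun.sum_left bounded_linear_Blinfun_apply)
qed

lemma cinner_proj_op: "cinner x (proj_op F y) = (\<Sum>e\<in>F. cinner x e * cinner e y)"
  by (simp add: proj_op_apply cinner_sum_right cinner_scaleC_right mult.commute)

lemma selfadjoint_proj_op: "selfadjoint_op (proj_op F)"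
  unfolding selfadjoint_op_def
proof (intro conjI allI)
  show "complex_linear (proj_op F)"
    unfolding complex_linear_def
  proof (intro allI)
    fix a and x :: 'a
    show "proj_op F (a *\<^sub>C x) = a *\<^sub>C proj_op F x"
      by (rule cinner_eqI)
        (simp only: cinner_proj_op cinner_scaleC_right sum_distrib_left mult.left_commute)
  qed
  fix x y
  have "cinner (proj_op F x) y = cnj (\<Sum>e\<in>F. cinner y e * cinner e x)"
    by (subst cinner_commute) (simp only: cinner_proj_op)
  also have "\<dots> = (\<Sum>e\<in>F. cinner x e * cinner e y)"
    by (simp only: cnj_sum complex_cnj_mult cinner_commute[symmetric] mult.commute)
  finally show "cinner x (proj_op F y) = cinner (proj_op F x) y"
    by (simp only: cinner_proj_op)
qed

lemma proj_op_orthogonal: "(\<And>e. e \<in> F \<Longrightarrow> cinner e x = 0) \<Longrightarrow> proj_op F x = 0"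
  by (rule cinner_eqI) (simp add: cinner_proj_op)

lemma proj_op_mem:
  assumes "finite F" "orthonormal_set F" "e \<in> F"
  shows "proj_op F e = e"
proof (rule cinner_eqI)
  fix z
  have "cinner z (proj_op F e) = (\<Sum>f\<in>F. if f = e then cinner z e else 0)"
    unfolding cinner_proj_op by (rule sum.cong) (use assms in \<open>auto simp: orthonormal_set_def\<close>)
  then show "cinner z (proj_op F e) = cinner z e"
    using assms by simp
qed

lemma qform_proj_op: "qform (proj_op F) x = (\<Sum>e\<in>F. (cmod (cinner e x))\<^sup>2)"
proof -
  have "cinner x e * cinner e x = of_real ((cmod (cinner e x))\<^sup>2)" for e
    using complex_norm_square[of "cinner x e"] cinner_commute[of e x]
    by (metis complex_mod_cnj)
  then have "cinner x (proj_op F x) = of_real (\<Sum>e\<in>F. (cmod (cinner e x))\<^sup>2)"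
    by (simp add: cinner_proj_op)
  then show ?thesis
    unfolding qform_def by (metis Re_cinner Re_complex_of_real)
qed

lemma positive_proj_op: "positive_op (proj_op F)"
  by (simp add: positive_op_iff selfadjoint_proj_op qform_proj_op sum_nonneg)

lemma norm_sq_diff_proj_op:
  assumes "finite F" "orthonormal_set F"
  shows "(norm (x - proj_op F x))\<^sup>2 = (norm x)\<^sup>2 - qform (proj_op F) x"
proof -
  have "(norm (x - proj_op F x))\<^sup>2
      = (norm x)\<^sup>2 - 2 * qform (proj_op F) x + (norm (proj_op F x))\<^sup>2"
    by (simp add: power2_norm_eq_inner qform_def inner_diff_left inner_diff_right inner_commute)
  also have "(norm (proj_op F x))\<^sup>2 = qform (proj_op F) x"
    unfolding proj_op_apply norm_orthonormal_sum[OF assms] qform_proj_op ..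
  finally show ?thesis
    by simp
qed

lemma bessel:
  fixes x :: "'a::complex_hilbert"
  assumes "finite F" "orthonormal_set F"
  shows "(\<Sum>e\<in>F. (cmod (cinner e x))\<^sup>2) \<le> (norm x)\<^sup>2"
  using norm_sq_diff_proj_op[OF assms, of x] zero_le_power2[of "norm (x - proj_op F x)"]
  by (simp add: qform_proj_op)

lemma norm_diff_proj_op_le:
  assumes "finite F" "orthonormal_set F"
  shows "norm (x - proj_op F x) \<le> norm x"
proof (rule power2_le_imp_le)
  show "(norm (x - proj_op F x))\<^sup>2 \<le> (norm x)\<^sup>2"
    using positive_proj_op[of F] by (simp add: norm_sq_diff_proj_op[OF assms] positive_op_iff)
qed simp

text \<open>
  The expansion need not converge absolutely. The Cauchy criterion holds because, by Pythagoras,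
  differences of partial sums are controlled by the tails of the summable squares from Bessel's
  inequality.
\<close>

lemma orthonormal_expansion_summable:
  fixes x :: "'a::complex_hilbert"
  assumes B: "orthonormal_set B"
  shows "(\<lambda>e. cinner e x *\<^sub>C e) summable_on B"
proof -
  define f where "f = (\<lambda>e. cinner e x *\<^sub>C e)"
  define g where "g = (\<lambda>e. (cmod (cinner e x))\<^sup>2)"
  have "g summable_on B"
  proof (rule nonneg_bdd_above_summable_on)
    show "bdd_above (sum g ` {F. F \<subseteq> B \<and> finite F})"
      using bessel[of _ x] orthonormal_set_subset[OF B]
      by (intro bdd_aboveI2[where M = "(norm x)\<^sup>2"]) (simp add: g_def)
  qed (simp add: g_def)
  then have sum: "(g has_sum infsum g B) B"
    by simp
  have "\<exists>P. eventually P (finite_subsets_at_top B) \<and>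
      (\<forall>F G. P F \<and> P G \<longrightarrow> dist (sum f F) (sum f G) < d)" if "d > 0" for d
  proof -
    have "(d/4)\<^sup>2 > 0"
      using that by simp
    from has_sum_finite_approximation[OF sum this]
    obtain F0 where F0: "finite F0" "F0 \<subseteq> B" "dist (sum g F0) (infsum g B) \<le> (d/4)\<^sup>2"
      by blast
    define P where "P F \<longleftrightarrow> finite F \<and> F0 \<subseteq> F \<and> F \<subseteq> B" for F
    have near: "dist (sum f F) (sum f F0) \<le> d/4" if "P F" for F
    proof -
      have F: "finite F" "F0 \<subseteq> F" "F \<subseteq> B"
        using that by (auto simp: P_def)
      have "(dist (sum f F) (sum f F0))\<^sup>2 = (norm (sum f (F - F0)))\<^sup>2"
        using F by (simp add: dist_norm sum_diff)
      also have "\<dots> = sum g (F - F0)"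
        unfolding f_def g_def
        by (rule norm_orthonormal_sum) (use F in \<open>auto intro: orthonormal_set_subset[OF B]\<close>)
      also have "\<dots> = sum g F - sum g F0"
        using F by (simp add: sum_diff)
      also have "\<dots> \<le> infsum g B - sum g F0"
        using finite_sum_le_has_sum[OF sum F(1,3)] by (simp add: g_def)
      also have "\<dots> \<le> (d/4)\<^sup>2"
        using F0(3) by (simp add: dist_real_def)
      finally show ?thesis
        using \<open>d > 0\<close> by (simp add: abs_le_square_iff[symmetric])
    qed
    have "dist (sum f F) (sum f G) < d" if "P F" "P G" for F G
      using near[OF that(1)] near[OF that(2)] \<open>d > 0\<close>
        dist_triangle2[of "sum f F" "sum f G" "sum f F0"] by linarith
    moreover have "eventually P (finite_subsets_at_top B)"
      unfolding eventually_finite_subsets_at_top P_def using F0 by blast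
    ultimately show ?thesis
      by blast
  qed
  then have "cauchy_filter (filtermap (sum f) (finite_subsets_at_top B))"
    by (simp add: cauchy_filter_metric_filtermap)
  moreover have "complete (UNIV::'a set)"
    by (meson Cauchy_convergent UNIV_I complete_def convergent_def)
  ultimately obtain L where "(sum f \<longlongrightarrow> L) (finite_subsets_at_top B)"
    using complete_uniform[where S = UNIV] by (force simp add: filterlim_def)
  then show ?thesis
    unfolding f_def summable_on_def has_sum_def by blast
qed

lemma orthonormal_expansion:
  fixes y :: "'a::complex_hilbert"
  assumes K: "closed_csubspace K" and B: "orthonormal_set B" "B \<subseteq> K"
  obtains s where "s \<in> K" "((\<lambda>e. cinner e y *\<^sub>C e) has_sum s) B"
    "\<And>e. e \<in> B \<Longrightarrow> cinner e (y - s) = 0"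
proof -
  obtain s where s: "((\<lambda>e. cinner e y *\<^sub>C e) has_sum s) B"
    using orthonormal_expansion_summable[OF B(1)] by (auto simp: summable_on_def)
  have "s \<in> K"
  proof (rule Lim_in_closed_set)
    show "closed K"
      using K by (simp add: closed_csubspace_def)
    show "(sum (\<lambda>e. cinner e y *\<^sub>C e) \<longlongrightarrow> s) (finite_subsets_at_top B)"
      using s by (simp add: has_sum_def)
    show "\<forall>\<^sub>F F in finite_subsets_at_top B. (\<Sum>e\<in>F. cinner e y *\<^sub>C e) \<in> K"
      using B(2) by (intro eventually_finite_subsets_at_top_weakI closed_csubspace_sum[OF K]) auto
  qed simp
  moreover have "cinner e (y - s) = 0" if e: "e \<in> B" for e
  proof -
    have "((\<lambda>f. cinner e (cinner f y *\<^sub>C f)) has_sum cinner e s) B"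
      by (intro has_sum_bounded_linear[OF _ s]
          bounded_bilinear.bounded_linear_right[OF bounded_bilinear_cinner])
    moreover have "((\<lambda>f. cinner e (cinner f y *\<^sub>C f)) has_sum cinner e y) B"
      by (rule has_sum_finite_neutralI[of "{e}"])
        (use e B(1) in \<open>auto simp: cinner_scaleC_right orthonormal_set_def\<close>)
    ultimately show ?thesis
      using has_sum_unique by (auto simp: cinner_diff_right)
  qed
  ultimately show thesis
    using s that by blast
qed

text \<open>
  The component in \<open>K\<close> is the sum of the expansion in a basis of \<open>K\<close>. The remainder is orthogonal to
  the basis, and therefore to every element of \<open>K\<close>, since these are sums of their own expansions.
\<close>

lemma orthogonal_decomposition:
  fixes x :: "'a::complex_hilbert"
  assumes K: "closed_csubspace K"
  obtains k where "k \<in> K" "\<And>y. y \<in> K \<Longrightarrow> cinner (x - k) y = 0"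
proof -
  obtain B where B: "B \<subseteq> K" "orthonormal_set B"
    and total: "\<And>x. x \<in> K \<Longrightarrow> (\<And>e. e \<in> B \<Longrightarrow> cinner e x = 0) \<Longrightarrow> x = 0"
    using orthonormal_extend[OF K, of "{}"] by (auto simp: orthonormal_set_def)
  obtain k where k: "k \<in> K" "\<And>e. e \<in> B \<Longrightarrow> cinner e (x - k) = 0"
    using orthonormal_expansion[OF K B(2,1), of x] by metis
  have "cinner (x - k) y = 0" if "y \<in> K" for y
  proof -
    obtain s where s: "s \<in> K" "((\<lambda>e. cinner e y *\<^sub>C e) has_sum s) B"
      "\<And>e. e \<in> B \<Longrightarrow> cinner e (y - s) = 0"
      using orthonormal_expansion[OF K B(2,1), of y] by metis
    have "y - s = 0"
      using closed_csubspace_diff[OF K that s(1)] s(3) by (rule total)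
    then have "((\<lambda>e. cinner e y *\<^sub>C e) has_sum y) B"
      using s(2) by simp
    then have "((\<lambda>e. cinner (x - k) (cinner e y *\<^sub>C e)) has_sum cinner (x - k) y) B"
      by (rule has_sum_bounded_linear[OF
            bounded_bilinear.bounded_linear_right[OF bounded_bilinear_cinner]])
    moreover have "cinner (x - k) e = 0" if "e \<in> B" for e
      using k(2)[OF that] by (metis cinner_commute complex_cnj_zero)
    then have "((\<lambda>e. cinner (x - k) (cinner e y *\<^sub>C e)) has_sum 0) B"
      by (intro has_sum_0) (simp add: cinner_scaleC_right)
    ultimately show ?thesis
      using has_sum_unique by blast
  qed
  then show thesis
    using that k(1) by blast
qed

lemma parseval:
  fixes x :: "'a::complex_hilbert"
  assumes "orthonormal_basis B"
  shows "((\<lambda>e. (cmod (cinner e x))\<^sup>2) has_sum (norm x)\<^sup>2) B"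
proof -
  obtain s where s: "((\<lambda>e. cinner e x *\<^sub>C e) has_sum s) B"
    "\<And>e. e \<in> B \<Longrightarrow> cinner e (x - s) = 0"
    using orthonormal_expansion[OF closed_csubspace_UNIV _ subset_UNIV, of B x] assms
    unfolding orthonormal_basis_iff by metis
  have "x - s = 0"
    using assms s(2) unfolding orthonormal_basis_iff by blast
  then have "((\<lambda>e. cinner e x *\<^sub>C e) has_sum x) B"
    using s(1) by simp
  then have "((\<lambda>e. inner x (cinner e x *\<^sub>C e)) has_sum inner x x) B"
    by (rule has_sum_bounded_linear[OF bounded_linear_inner_right])
  moreover have "inner x (cinner e x *\<^sub>C e) = (cmod (cinner e x))\<^sup>2" for e
  proof -
    have "cinner x (cinner e x *\<^sub>C e) = of_real ((cmod (cinner e x))\<^sup>2)"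
      by (metis cinner_scaleC_right complex_norm_square cinner_commute)
    then show ?thesis
      by (metis Re_cinner Re_complex_of_real)
  qed
  ultimately show ?thesis
    by (simp add: power2_norm_eq_inner)
qed

lemma has_sum_finite_sum:
  fixes f :: "'i \<Rightarrow> 'b \<Rightarrow> 'c::topological_comm_monoid_add"
  assumes "\<And>i. i \<in> I \<Longrightarrow> (f i has_sum s i) B"
  shows "((\<lambda>x. \<Sum>i\<in>I. f i x) has_sum (\<Sum>i\<in>I. s i)) B"
  using assms
  by (induction I rule: infinite_finite_induct) (auto intro: has_sum_add has_sum_0)

text \<open>
  With \<open>T = R\<^sup>2\<close>, expand each \<open>\<parallel>R g\<parallel>\<^sup>2\<close> by Parseval along \<open>B\<close> and bound the contribution of each \<open>e \<in> B\<close>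
  by \<open>\<parallel>R e\<parallel>\<^sup>2\<close> with Bessel. Only a finite sum is interchanged with the sum over the basis.
  Applied to finite subsets of a second basis, this makes the trace independent of the basis.
\<close>

lemma sum_qform_le_trace:
  assumes T: "positive_op T" and B: "orthonormal_basis B" "(qform T has_sum \<tau>) B"
    and G: "finite G" "orthonormal_set G"
  shows "(\<Sum>g\<in>G. qform T g) \<le> \<tau>"
proof -
  obtain R where R: "positive_op R" "R o\<^sub>L R = T"
    using positive_sqrt_exists[OF T] by blast
  have qT: "qform T x = (norm (R x))\<^sup>2" for x
    using R by (auto simp: qform_def positive_op_iff power2_norm_eq_inner selfadjoint_opD(3))
  show ?thesis
  proof (rule has_sum_mono[OF _ B(2)])
    show "((\<lambda>e. \<Sum>g\<in>G. (cmod (cinner e (R g)))\<^sup>2) has_sum (\<Sum>g\<in>G. qform T g)) B"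
      unfolding qT by (intro has_sum_finite_sum parseval B(1))
    fix e assume "e \<in> B"
    have "cmod (cinner e (R g)) = cmod (cinner g (R e))" for g
      using R(1) unfolding positive_op_iff
      by (metis cinner_commute complex_mod_cnj selfadjoint_opD(2))
    then have "(\<Sum>g\<in>G. (cmod (cinner e (R g)))\<^sup>2) = (\<Sum>g\<in>G. (cmod (cinner g (R e)))\<^sup>2)"
      by simp
    also have "\<dots> \<le> qform T e"
      unfolding qT by (rule bessel[OF G])
    finally show "(\<Sum>g\<in>G. (cmod (cinner e (R g)))\<^sup>2) \<le> qform T e" .
  qed
qed

lemma qform_has_sum_any_basis:
  assumes T: "positive_op T" and B: "orthonormal_basis B" "(qform T has_sum \<tau>) B"
    and B': "orthonormal_basis B'"
  shows "(qform T has_sum \<tau>) B'"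
proof -
  have le: "\<sigma>' \<le> \<sigma>" if "orthonormal_basis A" "orthonormal_basis A'" "(qform T has_sum \<sigma>) A"
    "(qform T has_sum \<sigma>') A'" for A A' \<sigma> \<sigma>'
    using that orthonormal_set_subset unfolding orthonormal_basis_iff[of A']
    by (intro has_sum_le_finite_sums[OF that(4)] sum_qform_le_trace[OF T that(1,3)]) auto
  have "qform T summable_on B'"
  proof (rule nonneg_bdd_above_summable_on)
    show "bdd_above (sum (qform T) ` {F. F \<subseteq> B' \<and> finite F})"
      using sum_qform_le_trace[OF T B] B' orthonormal_set_subset[of B'] unfolding orthonormal_basis_iff
      by (intro bdd_aboveI2[where M = \<tau>]) auto
  qed (use T in \<open>simp add: positive_op_iff\<close>)
  then obtain \<tau>' where \<tau>': "(qform T has_sum \<tau>') B'"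
    by (auto simp: summable_on_def)
  have "\<tau>' = \<tau>"
    using le[OF B(1) B' B(2) \<tau>'] le[OF B' B(1) \<tau>' B(2)] by simp
  with \<tau>' show ?thesis
    by simp
qed

lemma trace_op_positive:
  assumes T: "positive_op T" and B: "orthonormal_basis B" "(qform T has_sum \<tau>) B"
  shows "trace_op T = of_real \<tau>"
proof -
  have "orthonormal_basis (SOME B::'a set. orthonormal_basis B)"
    using B(1) by (rule someI)
  then have "(qform T has_sum \<tau>) (SOME B. orthonormal_basis B)"
    by (rule qform_has_sum_any_basis[OF T B])
  then have "((\<lambda>e. of_real (qform T e) :: complex) has_sum of_real \<tau>) (SOME B. orthonormal_basis B)"
    by (rule has_sum_of_real)
  then show ?thesis
    using T by (auto intro!: infsumI simp: trace_op_def positive_op_iff selfadjoint_qform)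
qed

lemma trace_class_coneI:
  assumes T: "positive_op T" and B: "orthonormal_basis B" "(qform T has_sum \<tau>) B"
  shows "T \<in> trace_class_cone"
proof -
  have "(\<lambda>e. cinner e (T e)) summable_on B"
    using has_sum_of_real[OF B(2), where 'a = complex] T
    by (auto simp: positive_op_iff selfadjoint_qform summable_on_def)
  then show ?thesis
    using T B(1) abs_op_positive[OF T]
    by (auto simp: trace_class_cone_def trace_class_def positive_op_def)
qed

lemma trace_class_coneD:
  assumes "T \<in> trace_class_cone"
  shows "positive_op T" and "orthonormal_basis B \<Longrightarrow> (qform T has_sum Re (trace_op T)) B"
proof -
  show T: "positive_op T"
    using assms by (simp add: trace_class_cone_def)
  obtain B' where B': "orthonormal_basis B'" "(\<lambda>e. cinner e (T e)) summable_on B'"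
    using assms abs_op_positive[OF T] by (auto simp: trace_class_cone_def trace_class_def)
  then have "qform T summable_on B'"
    using summable_on_Re[OF B'(2)] T by (simp add: positive_op_iff selfadjoint_qform)
  then have *: "(qform T has_sum infsum (qform T) B') B'"
    by simp
  show "(qform T has_sum Re (trace_op T)) B" if "orthonormal_basis B"
    using qform_has_sum_any_basis[OF T B'(1) * that] trace_op_positive[OF T B'(1) *] by simp
qed

lemma sum_qform_le_trace_cone:
  assumes "T \<in> trace_class_cone" "finite G" "orthonormal_set G"
  shows "(\<Sum>g\<in>G. qform T g) \<le> Re (trace_op T)"
  using assms orthonormal_basis_extend[of "{}::'a set"] trace_class_coneD[OF assms(1)]
  by (metis orthonormal_set_subset empty_subsetI sum_qform_le_trace)

section \<open>The trace norm of a difference of positive trace-class operators\<close>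

lemma closed_csubspace_coincidence:
  assumes "complex_linear S" "complex_linear T"
  shows "closed_csubspace {x. S x = T x}"
  unfolding closed_csubspace_def
proof (intro conjI)
  show "closed {x. S x = T x}"
    by (intro closed_Collect_eq linear_continuous_on blinfun.bounded_linear_right)
qed (use assms in \<open>simp_all add: blinfun.add_right complex_linear_def\<close>)

text \<open>
  As \<open>\<bar>X\<bar>\<close> commutes with \<open>X\<close> and has the same square, \<open>(\<bar>X\<bar> - X) (\<bar>X\<bar> + X) = 0\<close>: the range of
  \<open>\<bar>X\<bar> + X\<close> lies in the subspace where \<open>\<bar>X\<bar> = X\<close>. A vector orthogonal to this subspace is
  therefore annihilated by the self-adjoint operator \<open>\<bar>X\<bar> + X\<close>.
\<close>

lemma abs_op_eq_uminus:
  fixes X :: "'a::complex_hilbert \<Rightarrow>\<^sub>L 'a"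
  assumes X: "selfadjoint_op X" and orth: "\<And>y. abs_op X y = X y \<Longrightarrow> cinner x y = 0"
  shows "abs_op X x = - X x"
proof -
  let ?P = "abs_op X"
  have P: "selfadjoint_op ?P"
    using abs_op_selfadjoint(1)[OF X] by (simp add: positive_op_iff)
  have "?P x + X x = 0"
  proof (rule cinner_eqI)
    fix z
    have "?P (?P z + X z) = X (?P z + X z)"
      by (simp add: blinfun.add_right abs_op_selfadjoint[OF X])
    then have "cinner x (?P z + X z) = 0"
      by (rule orth)
    then have "cinner (?P x + X x) z = 0"
      using X P by (simp add: cinner_add_left cinner_add_right selfadjoint_opD)
    then show "cinner z (?P x + X x) = cinner z 0"
      by (metis cinner_commute cinner_zero_right complex_cnj_zero)
  qed
  then show ?thesis
    by (simp add: add_eq_0_iff2)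
qed

text \<open>
  Split \<open>x = k + l\<close> along the subspace where \<open>\<bar>X\<bar> = X\<close>. The splitting diagonalizes both forms: \<open>X\<close> and
  \<open>\<bar>X\<bar>\<close> agree at \<open>k\<close> and are opposite at \<open>l\<close>.
\<close>

lemma abs_qform_le:
  fixes X :: "'a::complex_hilbert \<Rightarrow>\<^sub>L 'a"
  assumes X: "selfadjoint_op X"
  shows "\<bar>qform X x\<bar> \<le> qform (abs_op X) x"
proof -
  let ?P = "abs_op X"
  have P: "positive_op ?P" "selfadjoint_op ?P"
    using abs_op_selfadjoint(1)[OF X] by (simp_all add: positive_op_iff)
  define K where "K = {x. ?P x = X x}"
  have "closed_csubspace K"
    unfolding K_def by (intro closed_csubspace_coincidence selfadjoint_opD(1) X P)
  then obtain k where "k \<in> K" "\<And>y. y \<in> K \<Longrightarrow> cinner (x - k) y = 0"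
    using orthogonal_decomposition[of K x] by metis
  then have k: "?P k = X k" "\<And>y. ?P y = X y \<Longrightarrow> cinner (x - k) y = 0"
    by (simp_all add: K_def)
  define l where "l = x - k"
  have l: "?P l = - X l"
    unfolding l_def by (intro abs_op_eq_uminus X k(2))
  have x: "x = k + l"
    by (simp add: l_def)
  have "inner k (?P l) = - inner k (?P l)"
    using k(1) l by (metis X P(2) inner_minus_right selfadjoint_opD(3))
  then have cross: "inner k (?P l) = 0"
    by simp
  then have cross': "inner l (?P k) = 0"
    by (metis P(2) inner_commute selfadjoint_opD(3))
  have "X l = - ?P l"
    using l by simp
  then have "qform X x = qform ?P k - qform ?P l"
    unfolding x qform_def
    by (simp add: blinfun.add_right inner_add_left inner_add_right inner_diff_right cross cross'
        flip: k(1))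
  moreover have "qform ?P x = qform ?P k + qform ?P l"
    unfolding x qform_def
    by (simp add: blinfun.add_right inner_add_left inner_add_right cross cross')
  moreover have "qform ?P k \<ge> 0" "qform ?P l \<ge> 0"
    using P by (simp_all add: positive_op_iff)
  ultimately show ?thesis
    by linarith
qed

text \<open>
  A basis of the subspace where \<open>\<bar>X\<bar> = X\<close>, completed to a basis of the whole space. The vectors of
  \<open>F\<close> lie in that subspace because \<open>X e = 0\<close> implies \<open>\<bar>X\<bar> e = 0\<close>, so the basis can be made to contain
  them.
\<close>

lemma norming_basis_exists:
  fixes X :: "'a::complex_hilbert \<Rightarrow>\<^sub>L 'a"
  assumes X: "selfadjoint_op X" and F: "orthonormal_set F" "\<And>e. e \<in> F \<Longrightarrow> X e = 0"
  obtains B where "F \<subseteq> B" "orthonormal_basis B" "\<And>b. b \<in> B \<Longrightarrow> qform (abs_op X) b = \<bar>qform X b\<bar>"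
proof -
  let ?P = "abs_op X"
  define K where "K = {x. ?P x = X x}"
  have P: "positive_op ?P" "selfadjoint_op ?P"
    using abs_op_selfadjoint(1)[OF X] by (simp_all add: positive_op_iff)
  have K: "closed_csubspace K"
    unfolding K_def by (intro closed_csubspace_coincidence selfadjoint_opD(1) X P)
  have "F \<subseteq> K"
  proof
    fix e assume "e \<in> F"
    have "inner (?P e) (?P e) = inner e (X (X e))"
      using P by (simp add: selfadjoint_opD abs_op_selfadjoint[OF X])
    then show "e \<in> K"
      using F(2)[OF \<open>e \<in> F\<close>] by (simp add: K_def)
  qed
  obtain B0 where B0: "F \<subseteq> B0" "B0 \<subseteq> K" "orthonormal_set B0"
    and total: "\<forall>x\<in>K. (\<forall>e\<in>B0. cinner e x = 0) \<longrightarrow> x = 0"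
    using orthonormal_extend[OF K F(1) \<open>F \<subseteq> K\<close>] by metis
  obtain B where B: "B0 \<subseteq> B" "orthonormal_basis B"
    using orthonormal_basis_extend[OF B0(3)] by metis
  have "qform ?P b = \<bar>qform X b\<bar>" if b: "b \<in> B" for b
  proof (cases "b \<in> B0")
    case True
    then have "?P b = X b"
      using B0(2) by (auto simp: K_def)
    then have "qform ?P b = qform X b"
      by (simp add: qform_def)
    moreover have "qform ?P b \<ge> 0"
      using P by (simp add: positive_op_iff)
    ultimately show ?thesis
      by simp
  next
    case False
    have orth: "cinner e b = 0" if "e \<in> B0" for e
      using B False b that by (auto simp: orthonormal_basis_iff orthonormal_set_def)
    obtain k where k: "k \<in> K" "\<And>y. y \<in> K \<Longrightarrow> cinner (b - k) y = 0"
      using orthogonal_decomposition[OF K, of b] by metis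
    \<comment> \<open>A vector outside the first basis has no component in the subspace.\<close>
    have "k = 0"
    proof (rule total[rule_format, OF k(1)])
      fix e assume e: "e \<in> B0"
      then have "cinner e (b - k) = 0"
        using k(2) B0(2) by (metis cinner_commute complex_cnj_zero subsetD)
      then show "cinner e k = 0"
        using orth[OF e] by (simp add: cinner_diff_right)
    qed
    then have "?P b = - X b"
      using k(2) by (intro abs_op_eq_uminus X) (simp add: K_def)
    then have "qform ?P b = - qform X b"
      by (simp add: qform_def)
    moreover have "qform ?P b \<ge> 0"
      using P by (simp add: positive_op_iff)
    ultimately show ?thesis
      by simp
  qed
  then show thesis
    using that B0(1) B by (meson subset_trans)
qed

lemma selfadjoint_cone_diff:
  "A \<in> trace_class_cone \<Longrightarrow> B \<in> trace_class_cone \<Longrightarrow> selfadjoint_op (A - B)"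
  by (simp add: selfadjoint_diff trace_class_coneD(1)[unfolded positive_op_iff])

text \<open>
  On a norming basis \<open>\<langle>c, \<bar>A - B\<bar> c\<rangle> = \<bar>\<langle>c, (A - B) c\<rangle>\<bar>\<close>, which is at most
  \<open>\<langle>c, A c\<rangle> + \<langle>c, B c\<rangle>\<close>.
\<close>

lemma abs_op_cone_diff:
  assumes A: "A \<in> trace_class_cone" and B: "B \<in> trace_class_cone"
  shows "abs_op (A - B) \<in> trace_class_cone"
proof -
  let ?P = "abs_op (A - B)"
  have X: "selfadjoint_op (A - B)"
    using A B by (rule selfadjoint_cone_diff)
  have pos: "positive_op A" "positive_op B" "positive_op ?P"
    using trace_class_coneD(1) A B abs_op_selfadjoint(1)[OF X] by blast+
  obtain C where C: "orthonormal_basis C"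
    "\<And>c. c \<in> C \<Longrightarrow> qform ?P c = \<bar>qform (A - B) c\<bar>"
    using norming_basis_exists[OF X orthonormal_set_empty] by (metis empty_iff)
  have "qform A summable_on C" "qform B summable_on C"
    using trace_class_coneD(2) A B C(1) by (auto simp: summable_on_def)
  then have majorant: "(\<lambda>c. qform A c + qform B c) summable_on C"
    by (rule summable_on_add)
  have "qform ?P summable_on C"
    by (rule summable_on_comparison_test[OF majorant])
      (use pos in \<open>auto simp: C(2) qform_diff positive_op_iff abs_le_iff\<close>)
  then show ?thesis
    using trace_class_coneI[OF pos(3) C(1)] by (auto simp: summable_on_def)
qed

lemma sum_abs_qform_le_trace_norm:
  assumes "A \<in> trace_class_cone" "B \<in> trace_class_cone" and G: "finite G" "orthonormal_set G"
  shows "(\<Sum>g\<in>G. \<bar>qform (A - B) g\<bar>) \<le> trace_norm (A - B)"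
proof -
  have "(\<Sum>g\<in>G. \<bar>qform (A - B) g\<bar>) \<le> (\<Sum>g\<in>G. qform (abs_op (A - B)) g)"
    by (intro sum_mono abs_qform_le selfadjoint_cone_diff assms)
  also have "\<dots> \<le> trace_norm (A - B)"
    unfolding trace_norm_def by (intro sum_qform_le_trace_cone abs_op_cone_diff assms)
  finally show ?thesis .
qed

lemma weighted_sum_qform_le_trace_norm:
  assumes "A \<in> trace_class_cone" "B \<in> trace_class_cone" "finite G" "orthonormal_set G"
    and w: "\<And>g. g \<in> G \<Longrightarrow> \<bar>w g\<bar> \<le> 1"
  shows "(\<Sum>g\<in>G. w g * qform (A - B) g) \<le> trace_norm (A - B)"
proof -
  have "w g * qform (A - B) g \<le> \<bar>qform (A - B) g\<bar>" if "g \<in> G" for g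
  proof -
    have "w g * qform (A - B) g \<le> \<bar>w g\<bar> * \<bar>qform (A - B) g\<bar>"
      by (metis abs_ge_self abs_mult)
    also have "\<dots> \<le> 1 * \<bar>qform (A - B) g\<bar>"
      by (intro mult_right_mono w that) simp
    finally show ?thesis
      by simp
  qed
  then have "(\<Sum>g\<in>G. w g * qform (A - B) g) \<le> (\<Sum>g\<in>G. \<bar>qform (A - B) g\<bar>)"
    by (rule sum_mono)
  then show ?thesis
    using sum_abs_qform_le_trace_norm[OF assms(1-4)] by linarith
qed

text \<open>
  A finite part of a norming basis. With a set \<open>F\<close> of null vectors the extremal set can be chosen
  orthogonal to \<open>F\<close>; this is used for operators compressed to the orthogonal complement of \<open>F\<close>.
\<close>

lemma trace_norm_almost_attained:
  assumes A: "A \<in> trace_class_cone" and B: "B \<in> trace_class_cone"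
    and F: "orthonormal_set F" "\<And>e. e \<in> F \<Longrightarrow> (A - B) e = 0" and "\<delta> > 0"
  obtains G where "finite G" "F \<inter> G = {}" "orthonormal_set (F \<union> G)"
    "trace_norm (A - B) \<le> (\<Sum>g\<in>G. \<bar>qform (A - B) g\<bar>) + \<delta>"
proof -
  have X: "selfadjoint_op (A - B)"
    using A B by (rule selfadjoint_cone_diff)
  obtain C where C: "F \<subseteq> C" "orthonormal_basis C"
    and norming: "\<And>c. c \<in> C \<Longrightarrow> qform (abs_op (A - B)) c = \<bar>qform (A - B) c\<bar>"
    using norming_basis_exists[OF X F(1)] F(2) by metis
  have "(qform (abs_op (A - B)) has_sum trace_norm (A - B)) C"
    unfolding trace_norm_def by (intro trace_class_coneD(2) abs_op_cone_diff A B C)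
  from has_sum_finite_approximation[OF this \<open>\<delta> > 0\<close>]
  obtain G0 where G0: "finite G0" "G0 \<subseteq> C"
    and near: "dist (\<Sum>g\<in>G0. qform (abs_op (A - B)) g) (trace_norm (A - B)) \<le> \<delta>"
    by blast
  show thesis
  proof (rule that[of "G0 - F"])
    show "orthonormal_set (F \<union> (G0 - F))"
      by (rule orthonormal_set_subset[of C]) (use C G0(2) in \<open>auto simp: orthonormal_basis_iff\<close>)
    have "(\<Sum>g\<in>G0. qform (abs_op (A - B)) g) = (\<Sum>g\<in>G0. \<bar>qform (A - B) g\<bar>)"
      using G0(2) norming by (intro sum.cong) auto
    also have "\<dots> = (\<Sum>g\<in>G0 - F. \<bar>qform (A - B) g\<bar>)"
      using G0(1) F(2) by (intro sum.mono_neutral_right) (auto simp: qform_def)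
    finally show "trace_norm (A - B) \<le> (\<Sum>g\<in>G0 - F. \<bar>qform (A - B) g\<bar>) + \<delta>"
      using near by (simp add: dist_real_def abs_le_iff)
  qed (use G0 in auto)
qed

lemma trace_class_cone_add:
  assumes A: "A \<in> trace_class_cone" and B: "B \<in> trace_class_cone"
  shows "A + B \<in> trace_class_cone"
    and "Re (trace_op (A + B)) = Re (trace_op A) + Re (trace_op B)"
proof -
  have pos: "positive_op (A + B)"
    using A B by (intro positive_add trace_class_coneD)
  obtain C :: "'a set" where C: "orthonormal_basis C"
    using orthonormal_basis_extend[OF orthonormal_set_empty] by metis
  have sum: "(qform (A + B) has_sum (Re (trace_op A) + Re (trace_op B))) C"
    using has_sum_add[OF trace_class_coneD(2)[OF A C] trace_class_coneD(2)[OF B C]]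
    by (simp add: qform_add[abs_def])
  show "A + B \<in> trace_class_cone"
    by (rule trace_class_coneI[OF pos C sum])
  show "Re (trace_op (A + B)) = Re (trace_op A) + Re (trace_op B)"
    by (simp add: trace_op_positive[OF pos C sum])
qed

lemma scaled_proj_op_cone:
  assumes F: "finite F" "orthonormal_set F" and "t \<ge> 0"
  shows "t *\<^sub>R proj_op F \<in> trace_class_cone"
proof -
  obtain B where B: "F \<subseteq> B" "orthonormal_basis B"
    using orthonormal_basis_extend[OF F(2)] by metis
  have "qform (t *\<^sub>R proj_op F) b = 0" if "b \<in> B - F" for b
  proof -
    have "cinner e b = 0" if "e \<in> F" for e
      using B \<open>b \<in> B - F\<close> that by (auto simp: orthonormal_basis_iff orthonormal_set_def)
    then show ?thesis
      by (simp add: qform_scaleR qform_proj_op)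
  qed
  then have "(qform (t *\<^sub>R proj_op F) has_sum (\<Sum>e\<in>F. qform (t *\<^sub>R proj_op F) e)) B"
    using F(1) B(1) by (intro has_sum_finite_neutralI[of F]) auto
  then show ?thesis
    using trace_class_coneI[OF positive_scaleR[OF positive_proj_op \<open>t \<ge> 0\<close>] B(2)] by blast
qed

definition compress :: "'a::complex_hilbert set \<Rightarrow> ('a \<Rightarrow>\<^sub>L 'a) \<Rightarrow> ('a \<Rightarrow>\<^sub>L 'a)"
  where "compress F T = (id_blinfun - proj_op F) o\<^sub>L T o\<^sub>L (id_blinfun - proj_op F)"

lemma qform_compress: "qform (compress F T) x = qform T (x - proj_op F x)"
proof -
  have "inner x (y - proj_op F y) = inner (x - proj_op F x) y" for y
    by (simp add: inner_diff_left inner_diff_right selfadjoint_opD(3)[OF selfadjoint_proj_op])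
  then show ?thesis
    by (simp add: qform_def compress_def blinfun.diff_left)
qed

lemma compress_diff: "compress F (A - B) = compress F A - compress F B"
  by (rule blinfun_eqI) (simp add: compress_def blinfun.bilinear_simps)

lemma compress_mem:
  assumes "finite F" "orthonormal_set F" "e \<in> F"
  shows "compress F T e = 0"
  by (simp add: compress_def blinfun.diff_left proj_op_mem[OF assms])

lemma qform_compress_orthogonal:
  assumes "\<And>e. e \<in> F \<Longrightarrow> cinner e x = 0"
  shows "qform (compress F T) x = qform T x"
  by (simp add: qform_compress proj_op_orthogonal[OF assms])

lemma positive_compress:
  assumes "positive_op T"
  shows "positive_op (compress F T)"
proof -
  define W where "W = id_blinfun - proj_op F"
  have W: "selfadjoint_op W"
    unfolding W_def by (intro selfadjoint_diff selfadjoint_id selfadjoint_proj_op)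
  have "selfadjoint_op (compress F T)"
    unfolding compress_def W_def[symmetric] selfadjoint_op_def complex_linear_def
    using W assms
    by (simp add: positive_op_iff complex_linearD selfadjoint_opD)
  then show ?thesis
    using assms by (simp add: positive_op_iff qform_compress)
qed

lemma compress_cone:
  assumes A: "A \<in> trace_class_cone" and F: "finite F" "orthonormal_set F"
  shows "compress F A \<in> trace_class_cone"
    and "Re (trace_op (compress F A)) = Re (trace_op A) - (\<Sum>e\<in>F. qform A e)"
proof -
  have pos: "positive_op (compress F A)"
    using A by (intro positive_compress trace_class_coneD)
  obtain B where B: "F \<subseteq> B" "orthonormal_basis B"
    using orthonormal_basis_extend[OF F(2)] by metis
  have "((\<lambda>b. if b \<in> F then - qform A b else 0) has_sum - (\<Sum>e\<in>F. qform A e)) B"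
    by (rule has_sum_finite_neutralI[OF F(1) B(1)]) (auto simp: sum_negf)
  from has_sum_add[OF trace_class_coneD(2)[OF A B(2)] this]
  have "((\<lambda>b. qform A b + (if b \<in> F then - qform A b else 0)) has_sum
      (Re (trace_op A) - (\<Sum>e\<in>F. qform A e))) B"
    by simp
  also have "?this \<longleftrightarrow> (qform (compress F A) has_sum
      (Re (trace_op A) - (\<Sum>e\<in>F. qform A e))) B"
  proof (rule has_sum_cong)
    fix b assume "b \<in> B"
    show "qform A b + (if b \<in> F then - qform A b else 0) = qform (compress F A) b"
    proof (cases "b \<in> F")
      case True
      then show ?thesis
        by (simp add: qform_def compress_mem[OF F])
    next
      case False
      then have "cinner e b = 0" if "e \<in> F" for e
        using B \<open>b \<in> B\<close> that by (auto simp: orthonormal_basis_iff orthonormal_set_def)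
      then show ?thesis
        using False by (simp add: qform_compress_orthogonal)
    qed
  qed
  finally have sum: "(qform (compress F A) has_sum (Re (trace_op A) - (\<Sum>e\<in>F. qform A e))) B" .
  show "compress F A \<in> trace_class_cone"
    by (rule trace_class_coneI[OF pos B(2) sum])
  show "Re (trace_op (compress F A)) = Re (trace_op A) - (\<Sum>e\<in>F. qform A e)"
    by (simp add: trace_op_positive[OF pos B(2) sum])
qed

text \<open>
  Let \<open>V = \<Sum>g\<in>G. s(g) |g\<rangle>\<langle>g|\<close>, a contraction, so that the left side is \<open>Tr (V X)\<close>. Its block outside
  \<open>F\<close> is the second term on the right. The rest is a sum over \<open>e \<in> F\<close> that depends only on
  \<open>V e\<close>. Compare \<open>V e\<close> with \<open>\<sigma>(e) e\<close> and put \<open>D = V e - \<sigma>(e) e\<close>. The part \<open>t \<sigma>(e) e\<close> of \<open>X e\<close> loses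
  \<open>t (1 - \<sigma>(e) \<langle>e, V e\<rangle>)\<close>, which is at least \<open>t \<parallel>D\<parallel>\<^sup>2 / 2\<close> because \<open>V\<close> is a contraction, whereas the
  bounded part gains at most \<open>2 M \<parallel>D\<parallel>\<close>. The maximum of \<open>2 M u - t u\<^sup>2 / 2\<close> is \<open>2 M\<^sup>2 / t\<close>.
\<close>

lemma block_estimate:
  fixes X :: "'a::complex_hilbert \<Rightarrow>\<^sub>L 'a" and \<sigma> s :: "'a \<Rightarrow> real"
  assumes X: "selfadjoint_op X"
    and F: "finite F" "orthonormal_set F" and \<sigma>: "\<And>e. e \<in> F \<Longrightarrow> \<bar>\<sigma> e\<bar> = 1"
    and "t > 0" and near: "\<And>e. e \<in> F \<Longrightarrow> norm (X e - (t * \<sigma> e) *\<^sub>R e) \<le> M"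
    and G: "finite G" "orthonormal_set G" and s: "\<And>g. g \<in> G \<Longrightarrow> \<bar>s g\<bar> \<le> 1"
  shows "(\<Sum>g\<in>G. s g * qform X g)
    \<le> (\<Sum>e\<in>F. \<sigma> e * qform X e) + (\<Sum>g\<in>G. s g * qform X (g - proj_op F g))
      + real (card F) * (2 * M\<^sup>2 / t)"
proof -
  let ?P = "proj_op F"
  \<comment> \<open>With \<open>u = P g\<close> and \<open>v = g - P g\<close>, the part of \<open>\<langle>g, X g\<rangle>\<close> other than \<open>\<langle>v, X v\<rangle>\<close> is
    \<open>\<langle>u, X (u + 2 v)\<rangle>\<close>, and \<open>u + 2 v = W g\<close>.\<close>
  define W where "W = 2 *\<^sub>R id_blinfun - ?P"
  have W: "selfadjoint_op W"
    unfolding W_def by (intro selfadjoint_diff selfadjoint_scaleR selfadjoint_id selfadjoint_proj_op)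
  define V where "V e = (\<Sum>g\<in>G. (of_real (s g) * cinner g e) *\<^sub>C g)" for e
  have split: "qform X g - qform X (g - ?P g) = (\<Sum>e\<in>F. Re (cinner g e * cinner (X e) (W g)))" for g
  proof -
    define u where "u = ?P g"
    define v where "v = g - u"
    have g: "g = u + v" and W_g: "W g = u + v + v"
      by (simp_all add: u_def v_def W_def blinfun.bilinear_simps scaleR_2)
    have "inner v (X u) = inner u (X v)"
      by (metis X inner_commute selfadjoint_opD(3))
    then have "qform X (u + v) - qform X v = inner u (X (u + v + v))"
      by (simp add: qform_def blinfun.add_right inner_add_left inner_add_right)
    then have "qform X g - qform X (g - ?P g) = inner (?P g) (X (W g))"
      unfolding W_g by (simp only: u_def[symmetric] v_def[symmetric] g[symmetric])
    also have "\<dots> = Re (cinner (?P g) (X (W g)))"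
      by (simp add: Re_cinner)
    also have "cinner (?P g) (X (W g)) = (\<Sum>e\<in>F. cinner g e * cinner (X e) (W g))"
      unfolding proj_op_apply cinner_sum_left cinner_scaleC_left selfadjoint_opD(2)[OF X]
      by (simp flip: cinner_commute)
    finally show ?thesis
      by simp
  qed
  have per_vector: "inner (X e) (W (V e)) \<le> \<sigma> e * qform X e + 2 * M\<^sup>2 / t" if e: "e \<in> F" for e
  proof -
    define D where "D = V e - \<sigma> e *\<^sub>R e"
    define r where "r = X e - (t * \<sigma> e) *\<^sub>R e"
    define d where "d = 1 - \<sigma> e * inner e (V e)"
    have Pe: "?P e = e"
      by (rule proj_op_mem[OF F e])
    have We: "W e = e"
      by (simp add: W_def blinfun.bilinear_simps Pe scaleR_2)
    have ee: "inner e e = 1"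
      using orthonormal_set_norm[OF F(2) e] by (simp add: norm_eq_1)
    have \<sigma>2: "\<sigma> e * \<sigma> e = 1"
      using \<sigma>[OF e] by (metis abs_mult_self_eq mult_1)
    have M: "norm r \<le> M"
      unfolding r_def by (rule near[OF e])
    have "inner (X e) (W (V e)) - \<sigma> e * qform X e = inner (X e) (W D)"
      by (simp add: D_def qform_def blinfun.bilinear_simps We inner_diff_right inner_commute)
    also have "\<dots> = t * \<sigma> e * inner e (W D) + inner r (W D)"
      by (simp add: r_def inner_diff_left)
    also have "inner e (W D) = inner e D"
      by (metis W We selfadjoint_opD(3))
    also have "t * \<sigma> e * inner e D = - t * d"
      by (simp add: D_def d_def inner_diff_right ee algebra_simps \<sigma>2 flip: mult.assoc)
    also have "inner r (W D) \<le> 2 * M * norm D"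
    proof -
      have "W D = D + (D - ?P D)"
        by (simp add: W_def blinfun.bilinear_simps scaleR_2)
      then have "norm (W D) \<le> 2 * norm D"
        using norm_triangle_ineq[of D "D - ?P D"] norm_diff_proj_op_le[OF F, of D] by simp
      then have "norm r * norm (W D) \<le> M * (2 * norm D)"
        using M by (intro mult_mono) (auto intro: order_trans[OF norm_ge_zero])
      then show ?thesis
        using norm_cauchy_schwarz[of r "W D"] by simp
    qed
    also have "- t * d + 2 * M * norm D \<le> 2 * M\<^sup>2 / t"
    proof -
      have "(norm (V e))\<^sup>2 = (\<Sum>g\<in>G. (cmod (of_real (s g) * cinner g e))\<^sup>2)"
        unfolding V_def by (rule norm_orthonormal_sum[OF G])
      also have "\<dots> \<le> (\<Sum>g\<in>G. (cmod (cinner g e))\<^sup>2)"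
        using s by (intro sum_mono power_mono) (auto simp: norm_mult mult_left_le_one_le)
      also have "\<dots> \<le> (norm e)\<^sup>2"
        by (rule bessel[OF G])
      finally have "inner (V e) (V e) \<le> 1"
        using ee by (simp add: power2_norm_eq_inner)
      moreover have "(norm D)\<^sup>2 = inner (V e) (V e) - 2 * (\<sigma> e * inner e (V e)) + 1"
        unfolding power2_norm_eq_inner
        by (simp add: D_def inner_diff_left inner_diff_right ee \<sigma>2 inner_commute algebra_simps)
      ultimately have "(norm D)\<^sup>2 \<le> 2 * d"
        by (simp add: d_def)
      then have "t * (norm D)\<^sup>2 \<le> t * (2 * d)"
        using \<open>t > 0\<close> by (intro mult_left_mono) auto
      moreover have "0 \<le> (t * norm D - 2 * M)\<^sup>2 / (2 * t)"
        using \<open>t > 0\<close> by simp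
      then have "0 \<le> t * (norm D)\<^sup>2 / 2 - 2 * M * norm D + 2 * M\<^sup>2 / t"
        using \<open>t > 0\<close> by (simp add: power2_diff power_mult_distrib field_simps power2_eq_square)
      ultimately show ?thesis
        by linarith
    qed
    finally show ?thesis
      by simp
  qed
  have "(\<Sum>g\<in>G. s g * qform X g) - (\<Sum>g\<in>G. s g * qform X (g - ?P g))
      = (\<Sum>g\<in>G. \<Sum>e\<in>F. s g * Re (cinner g e * cinner (X e) (W g)))"
    by (simp add: split flip: sum_subtractf right_diff_distrib sum_distrib_left)
  also have "\<dots> = (\<Sum>e\<in>F. \<Sum>g\<in>G. s g * Re (cinner g e * cinner (X e) (W g)))"
    by (rule sum.swap)
  also have "\<dots> = (\<Sum>e\<in>F. inner (X e) (W (V e)))"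
  proof (rule sum.cong[OF refl])
    fix e
    have "cinner (X e) (W (V e)) = (\<Sum>g\<in>G. of_real (s g) * (cinner g e * cinner (X e) (W g)))"
      by (simp add: V_def blinfun.sum_right complex_linearD[OF selfadjoint_opD(1)[OF W]]
          cinner_sum_right cinner_scaleC_right mult.assoc)
    then show "(\<Sum>g\<in>G. s g * Re (cinner g e * cinner (X e) (W g))) = inner (X e) (W (V e))"
      unfolding Re_cinner[symmetric] by simp
  qed
  also have "\<dots> \<le> (\<Sum>e\<in>F. \<sigma> e * qform X e + 2 * M\<^sup>2 / t)"
    by (intro sum_mono per_vector)
  finally show ?thesis
    by (simp add: sum.distrib)
qed

section \<open>Approximate isometries of the cone\<close>

text \<open>
  The block estimate shows that a nearly optimal test for \<open>A - B\<close> may use the weight \<open>\<sigma>\<close> on \<open>F\<close>. The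
  remaining block is the compression to the orthogonal complement of \<open>F\<close>; it vanishes on \<open>F\<close>, so its trace norm
  is almost attained on a finite set \<open>G\<close> orthogonal to \<open>F\<close>, where the compression has the same
  quadratic form as \<open>A - B\<close>.
\<close>

lemma trace_norm_near_sign_attained:
  fixes A B :: "'a::complex_hilbert \<Rightarrow>\<^sub>L 'a" and \<sigma> :: "'a \<Rightarrow> real"
  assumes A: "A \<in> trace_class_cone" and B: "B \<in> trace_class_cone"
    and F: "finite F" "orthonormal_set F" and \<sigma>: "\<And>e. e \<in> F \<Longrightarrow> \<bar>\<sigma> e\<bar> = 1"
    and "t > 0" and near: "\<And>e. e \<in> F \<Longrightarrow> norm ((A - B) e - (t * \<sigma> e) *\<^sub>R e) \<le> M"
    and "\<delta> > 0"
  obtains G where "finite G" "F \<inter> G = {}" "orthonormal_set (F \<union> G)"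
    "trace_norm (A - B) \<le> (\<Sum>e\<in>F. \<sigma> e * qform (A - B) e) + (\<Sum>g\<in>G. \<bar>qform (A - B) g\<bar>)
      + real (card F) * (2 * M\<^sup>2 / t) + \<delta>"
proof -
  let ?A' = "compress F A" and ?B' = "compress F B"
  have cone: "?A' \<in> trace_class_cone" "?B' \<in> trace_class_cone"
    using compress_cone(1) A B F by blast+
  have vanish: "(?A' - ?B') e = 0" if "e \<in> F" for e
    by (simp add: blinfun.diff_left compress_mem[OF F that])
  have "\<delta> / 2 > 0"
    using \<open>\<delta> > 0\<close> by simp
  obtain G where G: "finite G" "F \<inter> G = {}" "orthonormal_set (F \<union> G)"
    and attained: "trace_norm (?A' - ?B') \<le> (\<Sum>g\<in>G. \<bar>qform (?A' - ?B') g\<bar>) + \<delta> / 2"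
    using trace_norm_almost_attained[OF cone F(2) vanish \<open>\<delta> / 2 > 0\<close>] by metis
  have "qform (?A' - ?B') g = qform (A - B) g" if "g \<in> G" for g
  proof -
    have "cinner e g = 0" if "e \<in> F" for e
      using G(2,3) that \<open>g \<in> G\<close> unfolding orthonormal_set_def by (metis IntI UnCI empty_iff)
    then show ?thesis
      by (simp add: qform_compress_orthogonal flip: compress_diff)
  qed
  then have outside: "trace_norm (?A' - ?B') \<le> (\<Sum>g\<in>G. \<bar>qform (A - B) g\<bar>) + \<delta> / 2"
    using attained by simp
  obtain G' where G': "finite G'" "orthonormal_set G'"
    and attained': "trace_norm (A - B) \<le> (\<Sum>g\<in>G'. \<bar>qform (A - B) g\<bar>) + \<delta> / 2"
    using trace_norm_almost_attained[OF A B orthonormal_set_empty _ \<open>\<delta> / 2 > 0\<close>]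
    by (metis Un_empty_left empty_iff)
  define s where "s g = sgn (qform (A - B) g)" for g
  have s: "\<bar>s g\<bar> \<le> 1" "s g * qform (A - B) g = \<bar>qform (A - B) g\<bar>" for g
    by (simp_all add: s_def abs_sgn sgn_mult_self_eq abs_sgn_eq mult.commute)
  have "(\<Sum>g\<in>G'. s g * qform (A - B) g) \<le> (\<Sum>e\<in>F. \<sigma> e * qform (A - B) e)
      + (\<Sum>g\<in>G'. s g * qform (A - B) (g - proj_op F g)) + real (card F) * (2 * M\<^sup>2 / t)"
    by (rule block_estimate[OF selfadjoint_cone_diff[OF A B] F \<sigma> \<open>t > 0\<close> near G' s(1)])
  moreover have "(\<Sum>g\<in>G'. s g * qform (?A' - ?B') g) \<le> trace_norm (?A' - ?B')"
    by (intro weighted_sum_qform_le_trace_norm cone G' s(1))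
  then have "(\<Sum>g\<in>G'. s g * qform (A - B) (g - proj_op F g)) \<le> trace_norm (?A' - ?B')"
    by (simp add: qform_compress flip: compress_diff)
  ultimately have "trace_norm (A - B) \<le> (\<Sum>e\<in>F. \<sigma> e * qform (A - B) e)
      + (\<Sum>g\<in>G. \<bar>qform (A - B) g\<bar>) + real (card F) * (2 * M\<^sup>2 / t) + \<delta>"
    using attained' outside by (simp add: s(2))
  then show thesis
    using that G by blast
qed

text \<open>
  Up to \<open>O(1/t)\<close> the trace norm is the sum of those of the two diagonal blocks:
  \<open>t card F - Tr (P D)\<close> on the span of \<open>F\<close>, and \<open>Tr D - Tr (P D)\<close> outside it.
\<close>

lemma trace_norm_scaled_projection_diff_le:
  fixes D :: "'a::complex_hilbert \<Rightarrow>\<^sub>L 'a"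
  assumes D: "D \<in> trace_class_cone" and F: "finite F" "orthonormal_set F" and "t > 0"
  shows "trace_norm (t *\<^sub>R proj_op F - D)
    \<le> t * real (card F) + Re (trace_op D) - 2 * (\<Sum>e\<in>F. qform D e)
      + real (card F) * (2 * (norm D)\<^sup>2 / t)"
proof (rule field_le_epsilon)
  fix \<delta> :: real assume "\<delta> > 0"
  let ?X = "t *\<^sub>R proj_op F - D"
  have cone: "t *\<^sub>R proj_op F \<in> trace_class_cone"
    using \<open>t > 0\<close> by (intro scaled_proj_op_cone F) simp
  have near: "norm (?X e - (t * 1) *\<^sub>R e) \<le> norm D" if e: "e \<in> F" for e
    using norm_blinfun[of D e] orthonormal_set_norm[OF F(2) e]
    by (simp add: blinfun.bilinear_simps proj_op_mem[OF F e])
  obtain G where G: "finite G" "F \<inter> G = {}" "orthonormal_set (F \<union> G)"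
    and le: "trace_norm ?X \<le> (\<Sum>e\<in>F. 1 * qform ?X e) + (\<Sum>g\<in>G. \<bar>qform ?X g\<bar>)
      + real (card F) * (2 * (norm D)\<^sup>2 / t) + \<delta>"
    using trace_norm_near_sign_attained[OF cone D F _ \<open>t > 0\<close> near \<open>\<delta> > 0\<close>] by (metis abs_one)
  have "qform ?X e = t - qform D e" if e: "e \<in> F" for e
    using orthonormal_set_norm[OF F(2) e]
    by (simp add: qform_diff qform_scaleR) (simp add: qform_def proj_op_mem[OF F e] norm_eq_1)
  then have "(\<Sum>e\<in>F. 1 * qform ?X e) = t * real (card F) - (\<Sum>e\<in>F. qform D e)"
    by (simp add: sum_subtractf)
  moreover have "\<bar>qform ?X g\<bar> = qform D g" if "g \<in> G" for g
  proof -
    have "cinner e g = 0" if "e \<in> F" for e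
      using G(2,3) that \<open>g \<in> G\<close> unfolding orthonormal_set_def by (metis IntI UnCI empty_iff)
    moreover have "qform D g \<ge> 0"
      using trace_class_coneD(1)[OF D] by (simp add: positive_op_iff)
    ultimately show ?thesis
      by (simp add: qform_diff qform_scaleR qform_proj_op)
  qed
  then have "(\<Sum>g\<in>G. \<bar>qform ?X g\<bar>) = (\<Sum>g\<in>G. qform D g)"
    by simp
  moreover have "(\<Sum>e\<in>F. qform D e) + (\<Sum>g\<in>G. qform D g) \<le> Re (trace_op D)"
    using sum_qform_le_trace_cone[OF D _ G(3)] F(1) G(1,2) by (simp add: sum.union_disjoint)
  ultimately show "trace_norm ?X \<le> t * real (card F) + Re (trace_op D) - 2 * (\<Sum>e\<in>F. qform D e)
      + real (card F) * (2 * (norm D)\<^sup>2 / t) + \<delta>"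
    using le by linarith
qed

text \<open>
  The argument with the probes \<open>t P\<close> and \<open>t Q\<close> for a fixed finite set \<open>F\<close> that carries almost all of
  the trace; \<open>P\<close> and \<open>Q\<close> are the projections for \<open>F1\<close> and \<open>F2\<close>. The three \<open>\<delta>\<close>
  allow for the trace outside \<open>F\<close>, for the three \<open>O(1/t)\<close>
  errors together, and for the approximate attainment of \<open>\<parallel>S (t P) - S (t Q)\<parallel>\<^sub>1\<close>.
\<close>

lemma near_isometry_tested_on_basis:
  fixes S :: "('a::complex_hilbert \<Rightarrow>\<^sub>L 'a) \<Rightarrow> ('a \<Rightarrow>\<^sub>L 'a)" and \<epsilon> :: real
  assumes maps: "\<And>A. A \<in> trace_class_cone \<Longrightarrow> S A \<in> trace_class_cone"
    and isom: "\<And>A B. A \<in> trace_class_cone \<Longrightarrow> B \<in> trace_class_cone \<Longrightarrow>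
      \<bar>trace_norm (S A - S B) - trace_norm (A - B)\<bar> \<le> \<epsilon>"
    and bounded: "\<And>A. A \<in> trace_class_cone \<Longrightarrow> norm (S A - A) \<le> M"
    and D: "D \<in> trace_class_cone" and E: "E \<in> trace_class_cone"
    and F: "finite F" "orthonormal_set F"
    and tail: "Re (trace_op (D + E + (S D + S E))) - (\<Sum>e\<in>F. qform (D + E + (S D + S E)) e) \<le> \<delta>"
    and "\<delta> > 0"
  shows "(\<Sum>e\<in>F. \<bar>qform ((S D - S E) - (D - E)) e\<bar>) \<le> 3 * \<epsilon> + 3 * \<delta>"
proof -
  let ?Y = "(S D - S E) - (D - E)"
  \<comment> \<open>The sign is reversed so that \<open>S D\<close> enters the tests below with the sign that gives an upper bound.\<close>
  define \<sigma> where "\<sigma> e = (if qform ?Y e \<ge> 0 then - 1 else 1 :: real)" for e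
  define F1 where "F1 = {e \<in> F. \<sigma> e = 1}"
  define F2 where "F2 = {e \<in> F. \<sigma> e = - 1}"
  have "\<sigma> e = 1 \<or> \<sigma> e = - 1" for e
    by (simp add: \<sigma>_def)
  then have F12: "F = F1 \<union> F2" "F1 \<inter> F2 = {}"
    by (auto simp: F1_def F2_def)
  have F1: "finite F1" "orthonormal_set F1" and F2: "finite F2" "orthonormal_set F2"
    using F orthonormal_set_subset[OF F(2)] by (auto simp: F1_def F2_def)
  have sums: "(\<Sum>e\<in>F. f e) = (\<Sum>e\<in>F1. f e) + (\<Sum>e\<in>F2. f e)"
    "(\<Sum>e\<in>F. \<sigma> e * f e) = (\<Sum>e\<in>F1. f e) - (\<Sum>e\<in>F2. f e)" for f :: "'a \<Rightarrow> real"
  proof -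
    show "(\<Sum>e\<in>F. f e) = (\<Sum>e\<in>F1. f e) + (\<Sum>e\<in>F2. f e)" for f :: "'a \<Rightarrow> real"
      unfolding F12(1) using F1(1) F2(1) F12(2) by (rule sum.union_disjoint)
    from this[of "\<lambda>e. \<sigma> e * f e"] show "(\<Sum>e\<in>F. \<sigma> e * f e) = (\<Sum>e\<in>F1. f e) - (\<Sum>e\<in>F2. f e)"
      by (simp add: F1_def F2_def sum_negf)
  qed
  have card: "real (card F) = real (card F1) + real (card F2)"
    unfolding F12(1) using F1(1) F2(1) F12(2) by (simp add: card_Un_disjoint)

  define C where "C = real (card F) * (2 * (2 * M)\<^sup>2) + real (card F1) * (2 * (norm D)\<^sup>2)
    + real (card F2) * (2 * (norm E)\<^sup>2)"
  have "C \<ge> 0"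
    by (simp add: C_def)
  \<comment> \<open>The three errors are \<open>C / t\<close> in total.\<close>
  define t where "t = 1 + C / \<delta>"
  have "t > 0"
    using \<open>C \<ge> 0\<close> \<open>\<delta> > 0\<close> by (simp add: t_def add_pos_nonneg)
  have "C \<le> \<delta> * t"
    using \<open>\<delta> > 0\<close> by (simp add: t_def distrib_left)
  then have "C / t \<le> \<delta>"
    using \<open>t > 0\<close> by (simp add: pos_divide_le_eq)
  then have errors: "real (card F) * (2 * (2 * M)\<^sup>2 / t) + real (card F1) * (2 * (norm D)\<^sup>2 / t)
      + real (card F2) * (2 * (norm E)\<^sup>2 / t) \<le> \<delta>"
    by (simp add: C_def add_divide_distrib)

  let ?P = "t *\<^sub>R proj_op F1" and ?Q = "t *\<^sub>R proj_op F2"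
  have cone: "?P \<in> trace_class_cone" "?Q \<in> trace_class_cone"
    using \<open>t > 0\<close> F1 F2 by (simp_all add: scaled_proj_op_cone)
  have PQ: "(?P - ?Q) e = (t * \<sigma> e) *\<^sub>R e" if e: "e \<in> F" for e
  proof (cases "e \<in> F1")
    case True
    then have "cinner f e = 0" if "f \<in> F2" for f
      using F12 F(2) that unfolding orthonormal_set_def by (metis IntI UnCI empty_iff)
    then show ?thesis
      using True proj_op_mem[OF F1 True] proj_op_orthogonal[of F2 e]
      by (simp add: blinfun.bilinear_simps F1_def)
  next
    case False
    then have e2: "e \<in> F2"
      using e F12(1) by blast
    then have "cinner f e = 0" if "f \<in> F1" for f
      using F12 F(2) that unfolding orthonormal_set_def by (metis IntI UnCI empty_iff)
    then show ?thesis
      using e2 proj_op_mem[OF F2 e2] proj_op_orthogonal[of F1 e]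
      by (simp add: blinfun.bilinear_simps F2_def)
  qed

  have lower_PQ: "t * real (card F) \<le> trace_norm (?P - ?Q)"
  proof -
    have "\<bar>qform (?P - ?Q) e\<bar> = t" if e: "e \<in> F" for e
      using orthonormal_set_norm[OF F(2) e] \<open>t > 0\<close>
      by (simp add: qform_def PQ[OF e] norm_eq_1 \<sigma>_def)
    then show ?thesis
      using sum_abs_qform_le_trace_norm[OF cone F] by (simp add: mult.commute)
  qed
  let ?X = "S ?P - S ?Q"
  have near: "norm (?X e - (t * \<sigma> e) *\<^sub>R e) \<le> 2 * M" if e: "e \<in> F" for e
  proof -
    have "?X e - (t * \<sigma> e) *\<^sub>R e = (S ?P - ?P) e - (S ?Q - ?Q) e"
      unfolding PQ[OF e, symmetric] by (simp add: blinfun.diff_left)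
    also have "norm \<dots> \<le> norm ((S ?P - ?P) e) + norm ((S ?Q - ?Q) e)"
      by (rule norm_triangle_ineq4)
    also have "\<dots> \<le> M + M"
      using norm_blinfun[of "S ?P - ?P" e] norm_blinfun[of "S ?Q - ?Q" e]
        orthonormal_set_norm[OF F(2) e] bounded[OF cone(1)] bounded[OF cone(2)] by simp
    finally show ?thesis
      by simp
  qed
  have sign: "\<bar>\<sigma> e\<bar> = 1" for e
    by (simp add: \<sigma>_def)
  obtain G where G: "finite G" "F \<inter> G = {}" "orthonormal_set (F \<union> G)"
    and X_le: "trace_norm ?X \<le> (\<Sum>e\<in>F. \<sigma> e * qform ?X e) + (\<Sum>g\<in>G. \<bar>qform ?X g\<bar>)
      + real (card F) * (2 * (2 * M)\<^sup>2 / t) + \<delta>"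
    by (rule trace_norm_near_sign_attained[OF maps[OF cone(1)] maps[OF cone(2)] F sign \<open>t > 0\<close>
          near \<open>\<delta> > 0\<close>])

  define w where "w h = (if h \<in> F then \<sigma> h else sgn (qform ?X h))" for h
  have w: "\<bar>w h\<bar> \<le> 1" for h
    by (simp add: w_def \<sigma>_def abs_sgn_eq)
  let ?H = "F \<union> G"
  have H: "finite ?H"
    using F(1) G(1) by simp
  have sum_H: "(\<Sum>h\<in>?H. f h) = (\<Sum>e\<in>F. f e) + (\<Sum>g\<in>G. f g)" for f :: "'a \<Rightarrow> real"
    using F(1) G(1,2) by (rule sum.union_disjoint)
  have w_sum: "(\<Sum>h\<in>?H. w h * f h) = (\<Sum>e\<in>F. \<sigma> e * f e) + (\<Sum>g\<in>G. sgn (qform ?X g) * f g)"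
    for f :: "'a \<Rightarrow> real"
    unfolding sum_H using G(2)
    by (intro arg_cong2[of _ _ _ _ "(+)"] sum.cong) (auto simp: w_def)
  \<comment> \<open>The test weights for \<open>S (t P) - S D\<close> and their negatives for \<open>S (t Q) - S E\<close> add up to an almost
    optimal test of \<open>S (t P) - S (t Q)\<close>.\<close>
  have test_D: "(\<Sum>h\<in>?H. w h * qform (S ?P - S D) h) \<le> \<epsilon> + trace_norm (?P - D)"
    using weighted_sum_qform_le_trace_norm[OF maps[OF cone(1)] maps[OF D] H G(3), of w] w
      isom[OF cone(1) D] by simp
  have test_E: "(\<Sum>h\<in>?H. - w h * qform (S ?Q - S E) h) \<le> \<epsilon> + trace_norm (?Q - E)"
    using weighted_sum_qform_le_trace_norm[OF maps[OF cone(2)] maps[OF E] H G(3), of "\<lambda>h. - w h"] w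
      isom[OF cone(2) E] by simp
  have "(\<Sum>h\<in>?H. w h * qform (S ?P - S D) h) + (\<Sum>h\<in>?H. - w h * qform (S ?Q - S E) h)
      = (\<Sum>h\<in>?H. w h * qform ?X h) - (\<Sum>h\<in>?H. w h * qform (S D - S E) h)"
    by (simp add: qform_diff algebra_simps flip: sum.distrib sum_subtractf)
  moreover have "(\<Sum>h\<in>?H. w h * qform ?X h)
      = (\<Sum>e\<in>F. \<sigma> e * qform ?X e) + (\<Sum>g\<in>G. \<bar>qform ?X g\<bar>)"
    unfolding w_sum by (simp add: abs_sgn mult.commute)
  moreover have "t * real (card F) - \<epsilon> \<le> trace_norm ?X"
    using lower_PQ isom[OF cone] by linarith
  moreover have "(\<Sum>h\<in>?H. w h * qform (S D - S E) h)
      \<le> (\<Sum>e\<in>F. \<sigma> e * qform (S D - S E) e) + (\<Sum>g\<in>G. qform (S D + S E) g)"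
  proof -
    have "sgn (qform ?X g) * qform (S D - S E) g \<le> qform (S D + S E) g" for g
    proof -
      have "qform (S D) g \<ge> 0" "qform (S E) g \<ge> 0"
        using trace_class_coneD(1)[OF maps] D E by (simp_all add: positive_op_iff)
      then show ?thesis
        by (simp add: qform_diff qform_add sgn_real_def)
    qed
    then show ?thesis
      unfolding w_sum by (simp add: sum_mono)
  qed
  moreover have "(\<Sum>e\<in>F. qform (S D + S E) e) + (\<Sum>g\<in>G. qform (S D + S E) g)
      \<le> Re (trace_op (S D + S E))"
    using sum_qform_le_trace_cone[OF trace_class_cone_add(1)[OF maps[OF D] maps[OF E]] H G(3)]
    by (simp only: sum_H)
  moreover note trace_norm_scaled_projection_diff_le[OF D F1 \<open>t > 0\<close>]
    trace_norm_scaled_projection_diff_le[OF E F2 \<open>t > 0\<close>]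
  moreover have "Re (trace_op (D + E + (S D + S E)))
      = Re (trace_op D) + Re (trace_op E) + Re (trace_op (S D + S E))"
    using D E maps by (simp add: trace_class_cone_add)
  moreover have "(\<Sum>e\<in>F. qform (D + E + (S D + S E)) e)
      = (\<Sum>e\<in>F. qform D e) + (\<Sum>e\<in>F. qform E e) + (\<Sum>e\<in>F. qform (S D + S E) e)"
    by (simp add: qform_add sum.distrib)
  moreover have "(\<Sum>e\<in>F. \<bar>qform ?Y e\<bar>) = (\<Sum>e\<in>F. \<sigma> e * qform (D - E) e)
      - (\<Sum>e\<in>F. \<sigma> e * qform (S D - S E) e)"
  proof -
    have "\<bar>qform ?Y e\<bar> = \<sigma> e * qform (D - E) e - \<sigma> e * qform (S D - S E) e" for e
      by (auto simp: \<sigma>_def qform_diff)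
    then show ?thesis
      by (simp add: sum_subtractf)
  qed
  moreover have "(\<Sum>e\<in>F. \<sigma> e * qform (D - E) e)
      = (\<Sum>e\<in>F1. qform D e) - (\<Sum>e\<in>F2. qform D e) - (\<Sum>e\<in>F1. qform E e) + (\<Sum>e\<in>F2. qform E e)"
    unfolding sums(2) by (simp add: qform_diff sum_subtractf)
  moreover have "t * real (card F) = t * real (card F1) + t * real (card F2)"
    by (simp add: card distrib_left)
  ultimately show ?thesis
    using test_D test_E X_le errors tail sums(1)[of "qform D"] sums(1)[of "qform E"] \<open>\<delta> > 0\<close>
    by linarith
qed

theorem theorem4p1:
  fixes S :: "('a::complex_hilbert \<Rightarrow>\<^sub>L 'a) \<Rightarrow> ('a \<Rightarrow>\<^sub>L 'a)"
    and \<epsilon> :: real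
  assumes nonzero: "\<exists>x::'a. x \<noteq> 0"
    and eps: "\<epsilon> \<ge> 0"
    and maps: "\<forall>A\<in>trace_class_cone. S A \<in> trace_class_cone"
    and isom: "\<forall>A\<in>trace_class_cone. \<forall>B\<in>trace_class_cone.
      \<bar>trace_norm (S A - S B) - trace_norm (A - B)\<bar> \<le> \<epsilon>"
    and bounded: "bdd_above ((\<lambda>A. norm (S A - A)) ` trace_class_cone)"
  shows "\<forall>D\<in>trace_class_cone. \<forall>E\<in>trace_class_cone.
      trace_norm ((S D - S E) - (D - E)) \<le> 3 * \<epsilon>"
proof (intro ballI)
  fix D E :: "'a \<Rightarrow>\<^sub>L 'a"
  assume D: "D \<in> trace_class_cone" and E: "E \<in> trace_class_cone"
  let ?Y = "(S D - S E) - (D - E)" and ?Z = "D + E + (S D + S E)"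
  obtain M where M: "\<And>A. A \<in> trace_class_cone \<Longrightarrow> norm (S A - A) \<le> M"
    using bounded by (auto simp: bdd_above_def)
  have Y: "?Y = (S D + E) - (S E + D)"
    by simp
  have cone: "S D + E \<in> trace_class_cone" "S E + D \<in> trace_class_cone" "?Z \<in> trace_class_cone"
    using D E maps by (simp_all add: trace_class_cone_add)
  show "trace_norm ?Y \<le> 3 * \<epsilon>"
  proof (rule field_le_epsilon)
    fix d :: real assume "d > 0"
    define \<delta> where "\<delta> = d / 4"
    have "\<delta> > 0"
      using \<open>d > 0\<close> by (simp add: \<delta>_def)
    obtain F0 where F0: "finite F0" "orthonormal_set F0"
      and attained: "trace_norm ?Y \<le> (\<Sum>e\<in>F0. \<bar>qform ?Y e\<bar>) + \<delta>"
      unfolding Y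
      using trace_norm_almost_attained[OF cone(1,2) orthonormal_set_empty _ \<open>\<delta> > 0\<close>]
      by (metis Un_empty_left empty_iff)
    obtain B where B: "F0 \<subseteq> B" "orthonormal_basis B"
      using orthonormal_basis_extend[OF F0(2)] by metis
    obtain F' where F': "finite F'" "F' \<subseteq> B"
      "dist (\<Sum>e\<in>F'. qform ?Z e) (Re (trace_op ?Z)) \<le> \<delta>"
      using has_sum_finite_approximation[OF trace_class_coneD(2)[OF cone(3) B(2)] \<open>\<delta> > 0\<close>] by blast
    define F where "F = F0 \<union> F'"
    have F: "finite F" "orthonormal_set F"
      using F0 F' B orthonormal_set_subset[of B F] by (auto simp: F_def orthonormal_basis_iff)
    have "(\<Sum>e\<in>F'. qform ?Z e) \<le> (\<Sum>e\<in>F. qform ?Z e)"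
      using F(1) trace_class_coneD(1)[OF cone(3)]
      by (intro sum_mono2) (auto simp: F_def positive_op_iff)
    then have "Re (trace_op ?Z) - (\<Sum>e\<in>F. qform ?Z e) \<le> \<delta>"
      using F'(3) by (simp add: dist_real_def abs_le_iff)
    then have "(\<Sum>e\<in>F. \<bar>qform ?Y e\<bar>) \<le> 3 * \<epsilon> + 3 * \<delta>"
      using maps isom M D E F \<open>\<delta> > 0\<close> by (intro near_isometry_tested_on_basis[of S \<epsilon> M]) auto
    moreover have "(\<Sum>e\<in>F0. \<bar>qform ?Y e\<bar>) \<le> (\<Sum>e\<in>F. \<bar>qform ?Y e\<bar>)"
      using F(1) by (intro sum_mono2) (auto simp: F_def)
    ultimately show "trace_norm ?Y \<le> 3 * \<epsilon> + d"
      using attained by (simp add: \<delta>_def)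
  qed
qed

end
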